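(* Let $T$ be any axiomatic set theory with finitely many axioms. It is unprovable in $T$ (unless $T$ is inconsistent) that there exists a model of $T$. That is, if $T$ is consistent, then $T \nvdash$ "there exists a model of $T$".
   Context: "Axiomatic set theory" is meant in the usual sense. Provability $T \vdash \varphi$ is ordinary first-order provability from the axioms of $T$, and $T$ is inconsistent if it proves a contradiction. The sentence "there exists a model of $T$" is the sentence in the language of $T$ which formalizes, with the usual set-theoretic definitions of structure and satisfaction, the assertion that there is a structure (a nonempty set $M$ together with a binary relation $E \subseteq M \times M$ interpreting the membership symbol) which satisfies all of the finitely many axioms of $T$. *)

theory Defs
  imports Main
begin

section \<open>First-order logic over a single binary relation symbol\<close>

text \<open>Variables are natural numbers and are named, so a quantifier may rebind a variable.\<close>

datatype fm =
    Mem nat nat  (infix "\<^bold>\<in>" 70)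
  | Eq nat nat  (infix "\<^bold>=" 70)
  | Neg fm  ("\<^bold>\<not> _" [65] 65)
  | Imp fm fm  (infixr "\<^bold>\<longrightarrow>" 55)
  | All nat fm  ("\<^bold>\<forall>_. _" [100, 50] 50)

definition Conj :: "fm \<Rightarrow> fm \<Rightarrow> fm"  (infixr "\<^bold>\<and>" 62) where
  "\<phi> \<^bold>\<and> \<psi> = \<^bold>\<not> (\<phi> \<^bold>\<longrightarrow> \<^bold>\<not> \<psi>)"

definition Disj :: "fm \<Rightarrow> fm \<Rightarrow> fm"  (infixr "\<^bold>\<or>" 58) where
  "\<phi> \<^bold>\<or> \<psi> = (\<^bold>\<not> \<phi> \<^bold>\<longrightarrow> \<psi>)"

definition Iff :: "fm \<Rightarrow> fm \<Rightarrow> fm"  (infix "\<^bold>\<longleftrightarrow>" 53) where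
  "\<phi> \<^bold>\<longleftrightarrow> \<psi> = ((\<phi> \<^bold>\<longrightarrow> \<psi>) \<^bold>\<and> (\<psi> \<^bold>\<longrightarrow> \<phi>))"

definition Exists :: "nat \<Rightarrow> fm \<Rightarrow> fm"  ("\<^bold>\<exists>_. _" [100, 50] 50) where
  "(\<^bold>\<exists>x. \<phi>) = \<^bold>\<not> (\<^bold>\<forall>x. \<^bold>\<not> \<phi>)"

definition AllIn :: "nat \<Rightarrow> nat \<Rightarrow> fm \<Rightarrow> fm"  ("\<^bold>\<forall>_\<^bold>\<in>_. _" [100, 100, 50] 50) where
  "(\<^bold>\<forall>x\<^bold>\<in>y. \<phi>) = (\<^bold>\<forall>x. x \<^bold>\<in> y \<^bold>\<longrightarrow> \<phi>)"

definition ExIn :: "nat \<Rightarrow> nat \<Rightarrow> fm \<Rightarrow> fm"  ("\<^bold>\<exists>_\<^bold>\<in>_. _" [100, 100, 50] 50) where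
  "(\<^bold>\<exists>x\<^bold>\<in>y. \<phi>) = \<^bold>\<not> (\<^bold>\<forall>x\<^bold>\<in>y. \<^bold>\<not> \<phi>)"

primrec fv :: "fm \<Rightarrow> nat set" where
  "fv (x \<^bold>\<in> y) = {x, y}"
| "fv (x \<^bold>= y) = {x, y}"
| "fv (\<^bold>\<not> \<phi>) = fv \<phi>"
| "fv (\<phi> \<^bold>\<longrightarrow> \<psi>) = fv \<phi> \<union> fv \<psi>"
| "fv (\<^bold>\<forall>x. \<phi>) = fv \<phi> - {x}"

definition sentence :: "fm \<Rightarrow> bool" where
  "sentence \<phi> \<longleftrightarrow> fv \<phi> = {}"

text \<open>\<open>subst x y \<phi>\<close> puts \<open>y\<close> for the free occurrences of \<open>x\<close>; it may capture, which
  \<open>free_for y x \<phi>\<close> excludes.\<close>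

primrec subst :: "nat \<Rightarrow> nat \<Rightarrow> fm \<Rightarrow> fm" where
  "subst x y (u \<^bold>\<in> v) = ((if u = x then y else u) \<^bold>\<in> (if v = x then y else v))"
| "subst x y (u \<^bold>= v) = ((if u = x then y else u) \<^bold>= (if v = x then y else v))"
| "subst x y (\<^bold>\<not> \<phi>) = \<^bold>\<not> (subst x y \<phi>)"
| "subst x y (\<phi> \<^bold>\<longrightarrow> \<psi>) = (subst x y \<phi> \<^bold>\<longrightarrow> subst x y \<psi>)"
| "subst x y (\<^bold>\<forall>z. \<phi>) = (\<^bold>\<forall>z. (if z = x then \<phi> else subst x y \<phi>))"

primrec free_for :: "nat \<Rightarrow> nat \<Rightarrow> fm \<Rightarrow> bool" where
  "free_for y x (u \<^bold>\<in> v) \<longleftrightarrow> True"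
| "free_for y x (u \<^bold>= v) \<longleftrightarrow> True"
| "free_for y x (\<^bold>\<not> \<phi>) \<longleftrightarrow> free_for y x \<phi>"
| "free_for y x (\<phi> \<^bold>\<longrightarrow> \<psi>) \<longleftrightarrow> free_for y x \<phi> \<and> free_for y x \<psi>"
| "free_for y x (\<^bold>\<forall>z. \<phi>) \<longleftrightarrow> x \<notin> fv (\<^bold>\<forall>z. \<phi>) \<or> (z \<noteq> y \<and> free_for y x \<phi>)"

text \<open>A Hilbert calculus in the style of Enderton: all generalizations of logical axioms are
  axioms, and modus ponens is the only rule.\<close>

inductive logical_axiom :: "fm \<Rightarrow> bool" where
  K: "logical_axiom (\<phi> \<^bold>\<longrightarrow> \<psi> \<^bold>\<longrightarrow> \<phi>)"
| S: "logical_axiom ((\<phi> \<^bold>\<longrightarrow> \<psi> \<^bold>\<longrightarrow> \<chi>) \<^bold>\<longrightarrow> (\<phi> \<^bold>\<longrightarrow> \<psi>) \<^bold>\<longrightarrow> \<phi> \<^bold>\<longrightarrow> \<chi>)"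
| Contrapos: "logical_axiom ((\<^bold>\<not> \<phi> \<^bold>\<longrightarrow> \<^bold>\<not> \<psi>) \<^bold>\<longrightarrow> \<psi> \<^bold>\<longrightarrow> \<phi>)"
| Inst: "free_for y x \<phi> \<Longrightarrow> logical_axiom ((\<^bold>\<forall>x. \<phi>) \<^bold>\<longrightarrow> subst x y \<phi>)"
| Distrib: "logical_axiom ((\<^bold>\<forall>x. \<phi> \<^bold>\<longrightarrow> \<psi>) \<^bold>\<longrightarrow> (\<^bold>\<forall>x. \<phi>) \<^bold>\<longrightarrow> (\<^bold>\<forall>x. \<psi>))"
| Vacuous: "x \<notin> fv \<phi> \<Longrightarrow> logical_axiom (\<phi> \<^bold>\<longrightarrow> (\<^bold>\<forall>x. \<phi>))"
| Refl: "logical_axiom (x \<^bold>= x)"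
| Eq_Eq: "logical_axiom (x \<^bold>= y \<^bold>\<longrightarrow> x \<^bold>= z \<^bold>\<longrightarrow> y \<^bold>= z)"
| Eq_Mem_left: "logical_axiom (x \<^bold>= y \<^bold>\<longrightarrow> x \<^bold>\<in> z \<^bold>\<longrightarrow> y \<^bold>\<in> z)"
| Eq_Mem_right: "logical_axiom (x \<^bold>= y \<^bold>\<longrightarrow> z \<^bold>\<in> x \<^bold>\<longrightarrow> z \<^bold>\<in> y)"
| Gen: "logical_axiom \<phi> \<Longrightarrow> logical_axiom (\<^bold>\<forall>x. \<phi>)"

inductive proves :: "fm set \<Rightarrow> fm \<Rightarrow> bool"  (infix "\<turnstile>" 45) for T where
  Logic: "logical_axiom \<phi> \<Longrightarrow> T \<turnstile> \<phi>"
| Assum: "\<phi> \<in> T \<Longrightarrow> T \<turnstile> \<phi>"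
| MP: "T \<turnstile> (\<phi> \<^bold>\<longrightarrow> \<psi>) \<Longrightarrow> T \<turnstile> \<phi> \<Longrightarrow> T \<turnstile> \<psi>"

definition consistent :: "fm set \<Rightarrow> bool" where
  "consistent T \<longleftrightarrow> \<not> (\<exists>\<phi>. T \<turnstile> \<phi> \<and> T \<turnstile> \<^bold>\<not> \<phi>)"

section \<open>Axiomatic set theories\<close>

text \<open>A variable larger than all the given ones. Each formula below that has variables as
  arguments binds only variables fresh for its arguments, which rules out capture.\<close>

definition fresh :: "nat list \<Rightarrow> nat" where
  "fresh xs = Suc (sum_list xs)"

text \<open>In order to cover theories of classes such as von Neumann--Bernays--Goedel, whose
  objects are classes, a set is an object that belongs to some object. In the presence of
  pairing for all objects, as in subsystems of ZF, every object is a set in this sense.\<close>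

definition is_set :: "nat \<Rightarrow> fm" where
  "is_set x = (let y = fresh [x] in \<^bold>\<exists>y. x \<^bold>\<in> y)"

definition AllSet :: "nat \<Rightarrow> fm \<Rightarrow> fm" where
  "AllSet x \<phi> = (\<^bold>\<forall>x. is_set x \<^bold>\<longrightarrow> \<phi>)"

definition ExSet :: "nat \<Rightarrow> fm \<Rightarrow> fm" where
  "ExSet x \<phi> = (\<^bold>\<exists>x. is_set x \<^bold>\<and> \<phi>)"

inductive bounded :: "fm \<Rightarrow> bool" where
  "bounded (x \<^bold>\<in> y)"
| "bounded (x \<^bold>= y)"
| "bounded \<phi> \<Longrightarrow> bounded (\<^bold>\<not> \<phi>)"
| "bounded \<phi> \<Longrightarrow> bounded \<psi> \<Longrightarrow> bounded (\<phi> \<^bold>\<longrightarrow> \<psi>)"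
| "x \<noteq> y \<Longrightarrow> bounded \<phi> \<Longrightarrow> bounded (\<^bold>\<forall>x\<^bold>\<in>y. \<phi>)"

definition is_empty :: "nat \<Rightarrow> fm" where
  "is_empty z = (let w = fresh [z] in \<^bold>\<forall>w. \<^bold>\<not> w \<^bold>\<in> z)"

definition is_upair :: "nat \<Rightarrow> nat \<Rightarrow> nat \<Rightarrow> fm" where  \<comment> \<open>\<open>z = {x, y}\<close>\<close>
  "is_upair x y z = (let w = fresh [x, y, z] in \<^bold>\<forall>w. w \<^bold>\<in> z \<^bold>\<longleftrightarrow> w \<^bold>= x \<^bold>\<or> w \<^bold>= y)"

definition is_pair :: "nat \<Rightarrow> nat \<Rightarrow> nat \<Rightarrow> fm" where  \<comment> \<open>\<open>z = {{x}, {x, y}}\<close>\<close>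
  "is_pair x y z =
    (let w = fresh [x, y, z] in \<^bold>\<forall>w. w \<^bold>\<in> z \<^bold>\<longleftrightarrow> is_upair x x w \<^bold>\<or> is_upair x y w)"

definition Extensionality_axiom :: fm where
  "Extensionality_axiom = (\<^bold>\<forall>0. \<^bold>\<forall>1. (\<^bold>\<forall>2. 2 \<^bold>\<in> 0 \<^bold>\<longleftrightarrow> 2 \<^bold>\<in> 1) \<^bold>\<longrightarrow> 0 \<^bold>= 1)"

definition Empty_set_axiom :: fm where
  "Empty_set_axiom = ExSet 0 (is_empty 0)"

definition Pairing_axiom :: fm where
  "Pairing_axiom = AllSet 0 (AllSet 1 (ExSet 2 (is_upair 0 1 2)))"

definition Union_axiom :: fm where
  "Union_axiom = AllSet 0 (ExSet 1 (\<^bold>\<forall>2. 2 \<^bold>\<in> 1 \<^bold>\<longleftrightarrow> (\<^bold>\<exists>3\<^bold>\<in>0. 2 \<^bold>\<in> 3)))"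

definition Product_axiom :: fm where
  "Product_axiom = AllSet 0 (AllSet 1 (ExSet 2
    (\<^bold>\<forall>3. 3 \<^bold>\<in> 2 \<^bold>\<longleftrightarrow> (\<^bold>\<exists>4\<^bold>\<in>0. \<^bold>\<exists>5\<^bold>\<in>1. is_pair 4 5 3))))"

text \<open>\<open>{x \<in> a. \<phi>}\<close> is a set, with parameters \<open>ps\<close>.\<close>

definition Separation :: "nat \<Rightarrow> nat \<Rightarrow> nat \<Rightarrow> nat list \<Rightarrow> fm \<Rightarrow> fm" where
  "Separation x a z ps \<phi> = foldr AllSet ps (AllSet a (ExSet z
    (\<^bold>\<forall>x. x \<^bold>\<in> z \<^bold>\<longleftrightarrow> x \<^bold>\<in> a \<^bold>\<and> \<phi>)))"

text \<open>\<open>{{u \<in> a. \<phi>} | v \<in> b}\<close> is a set, with parameters \<open>ps\<close>. For bounded \<open>\<phi>\<close> (rudimentary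
  replacement) this follows from bounded separation together with either the power set axiom
  or bounded collection.\<close>

definition Family :: "nat \<Rightarrow> nat \<Rightarrow> nat \<Rightarrow> nat \<Rightarrow> nat \<Rightarrow> nat \<Rightarrow> nat list \<Rightarrow> fm \<Rightarrow> fm" where
  "Family u v a b w z ps \<phi> = foldr AllSet ps (AllSet a (AllSet b (ExSet z
    (\<^bold>\<forall>w. w \<^bold>\<in> z \<^bold>\<longleftrightarrow> is_set w \<^bold>\<and> (\<^bold>\<exists>v\<^bold>\<in>b. \<^bold>\<forall>u. u \<^bold>\<in> w \<^bold>\<longleftrightarrow> u \<^bold>\<in> a \<^bold>\<and> \<phi>)))))"

text \<open>The basic axioms. They are theorems of all the usual set theories: of (sufficiently
  large finite parts of) Zermelo, Zermelo--Fraenkel without power set, and Kripke--Platek set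
  theory, and of von Neumann--Bernays--Goedel. The two schemas are restricted to bounded
  formulas since a theory with finitely many axioms cannot be expected to prove separation for
  all formulas.\<close>

inductive_set basic_axioms :: "fm set" where
  "Extensionality_axiom \<in> basic_axioms"
| "Empty_set_axiom \<in> basic_axioms"
| "Pairing_axiom \<in> basic_axioms"
| "Union_axiom \<in> basic_axioms"
| "Product_axiom \<in> basic_axioms"
| "\<lbrakk>bounded \<phi>; distinct [x, a, z]; z \<notin> fv \<phi>; fv \<phi> \<subseteq> {x, a} \<union> set ps\<rbrakk>
    \<Longrightarrow> Separation x a z ps \<phi> \<in> basic_axioms"
| "\<lbrakk>bounded \<phi>; distinct [u, v, a, b, w, z]; fv \<phi> \<inter> {w, z} = {};
     fv \<phi> \<subseteq> {u, v, a, b} \<union> set ps\<rbrakk>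
    \<Longrightarrow> Family u v a b w z ps \<phi> \<in> basic_axioms"

definition axiomatic_set_theory :: "fm set \<Rightarrow> bool" where
  "axiomatic_set_theory T \<longleftrightarrow>
    (\<forall>\<phi>\<in>T. sentence \<phi>) \<and> (\<forall>\<phi>\<in>basic_axioms. T \<turnstile> \<phi>)"

section \<open>Structures and satisfaction inside set theory\<close>

definition is_succ :: "nat \<Rightarrow> nat \<Rightarrow> fm" where  \<comment> \<open>\<open>y = x \<union> {x}\<close>\<close>
  "is_succ x y = (let w = fresh [x, y] in \<^bold>\<forall>w. w \<^bold>\<in> y \<^bold>\<longleftrightarrow> w \<^bold>\<in> x \<^bold>\<or> w \<^bold>= x)"

primrec is_num :: "nat \<Rightarrow> nat \<Rightarrow> fm" where  \<comment> \<open>\<open>x\<close> is the von Neumann numeral of the first argument\<close>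
  "is_num 0 x = is_empty x"
| "is_num (Suc n) x = (let y = fresh [x] in \<^bold>\<exists>y. is_num n y \<^bold>\<and> is_succ y x)"

definition is_triple :: "nat \<Rightarrow> nat \<Rightarrow> nat \<Rightarrow> nat \<Rightarrow> fm" where  \<comment> \<open>\<open>d = (x, (y, z))\<close>\<close>
  "is_triple x y z d = (let p = fresh [x, y, z, d] in \<^bold>\<exists>p. is_pair y z p \<^bold>\<and> is_pair x p d)"

definition pair_in :: "nat \<Rightarrow> nat \<Rightarrow> nat \<Rightarrow> fm" where  \<comment> \<open>\<open>(x, y) \<in> r\<close>\<close>
  "pair_in x y r = (let p = fresh [x, y, r] in \<^bold>\<exists>p\<^bold>\<in>r. is_pair x y p)"

text \<open>\<open>is_code \<phi> d\<close>: the set \<open>d\<close> codes the formula \<open>\<phi>\<close>, where \<open>x \<in> y\<close>, \<open>x = y\<close>, \<open>\<not> \<phi>\<close>,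
  \<open>\<phi> \<longrightarrow> \<psi>\<close>, \<open>\<forall>x. \<phi>\<close> are coded by \<open>(0, (x, y))\<close>, \<open>(1, (x, y))\<close>, \<open>(2, \<phi>)\<close>, \<open>(3, (\<phi>, \<psi>))\<close>,
  \<open>(4, (x, \<phi>))\<close>, and a variable by its numeral.\<close>

primrec is_code :: "fm \<Rightarrow> nat \<Rightarrow> fm" where
  "is_code (x \<^bold>\<in> y) d = (let t = fresh [d]; i = t + 1; j = t + 2 in
    \<^bold>\<exists>t. \<^bold>\<exists>i. \<^bold>\<exists>j. is_num 0 t \<^bold>\<and> is_num x i \<^bold>\<and> is_num y j \<^bold>\<and> is_triple t i j d)"
| "is_code (x \<^bold>= y) d = (let t = fresh [d]; i = t + 1; j = t + 2 in
    \<^bold>\<exists>t. \<^bold>\<exists>i. \<^bold>\<exists>j. is_num 1 t \<^bold>\<and> is_num x i \<^bold>\<and> is_num y j \<^bold>\<and> is_triple t i j d)"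
| "is_code (\<^bold>\<not> \<phi>) d = (let t = fresh [d]; a = t + 1 in
    \<^bold>\<exists>t. \<^bold>\<exists>a. is_num 2 t \<^bold>\<and> is_code \<phi> a \<^bold>\<and> is_pair t a d)"
| "is_code (\<phi> \<^bold>\<longrightarrow> \<psi>) d = (let t = fresh [d]; a = t + 1; b = t + 2 in
    \<^bold>\<exists>t. \<^bold>\<exists>a. \<^bold>\<exists>b. is_num 3 t \<^bold>\<and> is_code \<phi> a \<^bold>\<and> is_code \<psi> b \<^bold>\<and> is_triple t a b d)"
| "is_code (\<^bold>\<forall>x. \<phi>) d = (let t = fresh [d]; i = t + 1; a = t + 2 in
    \<^bold>\<exists>t. \<^bold>\<exists>i. \<^bold>\<exists>a. is_num 4 t \<^bold>\<and> is_num x i \<^bold>\<and> is_code \<phi> a \<^bold>\<and> is_triple t i a d)"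

definition is_structure :: "nat \<Rightarrow> nat \<Rightarrow> fm" where  \<comment> \<open>\<open>M \<noteq> {}\<close> and \<open>E \<subseteq> M \<times> M\<close>\<close>
  "is_structure M E = (let p = fresh [M, E]; x = p + 1; y = p + 2 in
    (\<^bold>\<exists>x. x \<^bold>\<in> M) \<^bold>\<and> (\<^bold>\<forall>p\<^bold>\<in>E. \<^bold>\<exists>x\<^bold>\<in>M. \<^bold>\<exists>y\<^bold>\<in>M. is_pair x y p))"

definition is_function :: "nat \<Rightarrow> nat \<Rightarrow> nat \<Rightarrow> fm" where  \<comment> \<open>\<open>s\<close> is a function from \<open>I\<close> to \<open>M\<close>\<close>
  "is_function s I M = (let p = fresh [s, I, M]; i = p + 1; x = p + 2; y = p + 3 in
    (\<^bold>\<forall>p\<^bold>\<in>s. \<^bold>\<exists>i\<^bold>\<in>I. \<^bold>\<exists>x\<^bold>\<in>M. is_pair i x p) \<^bold>\<and>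
    (\<^bold>\<forall>i\<^bold>\<in>I. \<^bold>\<exists>x\<^bold>\<in>M. pair_in i x s \<^bold>\<and> (\<^bold>\<forall>y\<^bold>\<in>M. pair_in i y s \<^bold>\<longrightarrow> y \<^bold>= x)))"

text \<open>Satisfaction in \<open>(M, E)\<close> is defined by recursion on formula codes. Here \<open>D\<close> is a set of
  codes closed under immediate subformulas and with all variables in \<open>I\<close>, \<open>A\<close> is the set of
  assignments of elements of \<open>M\<close> to the variables in \<open>I\<close>, and \<open>(d, s) \<in> F\<close> says that \<open>(M, E)\<close>
  satisfies \<open>d\<close> under \<open>s\<close>; Tarski's clauses are required for all \<open>d \<in> D\<close>. The set \<open>I\<close> stands
  in for the set of all variables, which need not exist as the axiom of infinity is not
  assumed.\<close>

definition tarski_clauses :: "nat \<Rightarrow> nat \<Rightarrow> nat \<Rightarrow> nat \<Rightarrow> nat \<Rightarrow> nat \<Rightarrow> fm" where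
  "tarski_clauses M E I A D F =
    (let d = fresh [M, E, I, A, D, F]; t = d + 1; i = d + 2; j = d + 3; a = d + 4; b = d + 5;
         s = d + 6; r = d + 7; x = d + 8; y = d + 9 in
    \<^bold>\<forall>d\<^bold>\<in>D.
      (\<^bold>\<exists>t. is_num 0 t \<^bold>\<and> (\<^bold>\<exists>i\<^bold>\<in>I. \<^bold>\<exists>j\<^bold>\<in>I. is_triple t i j d \<^bold>\<and>
        (\<^bold>\<forall>s\<^bold>\<in>A. pair_in d s F \<^bold>\<longleftrightarrow>
          (\<^bold>\<exists>x\<^bold>\<in>M. \<^bold>\<exists>y\<^bold>\<in>M. pair_in i x s \<^bold>\<and> pair_in j y s \<^bold>\<and> pair_in x y E))))
    \<^bold>\<or> (\<^bold>\<exists>t. is_num 1 t \<^bold>\<and> (\<^bold>\<exists>i\<^bold>\<in>I. \<^bold>\<exists>j\<^bold>\<in>I. is_triple t i j d \<^bold>\<and>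
        (\<^bold>\<forall>s\<^bold>\<in>A. pair_in d s F \<^bold>\<longleftrightarrow>
          (\<^bold>\<exists>x\<^bold>\<in>M. \<^bold>\<exists>y\<^bold>\<in>M. pair_in i x s \<^bold>\<and> pair_in j y s \<^bold>\<and> x \<^bold>= y))))
    \<^bold>\<or> (\<^bold>\<exists>t. is_num 2 t \<^bold>\<and> (\<^bold>\<exists>a\<^bold>\<in>D. is_pair t a d \<^bold>\<and>
        (\<^bold>\<forall>s\<^bold>\<in>A. pair_in d s F \<^bold>\<longleftrightarrow> \<^bold>\<not> pair_in a s F)))
    \<^bold>\<or> (\<^bold>\<exists>t. is_num 3 t \<^bold>\<and> (\<^bold>\<exists>a\<^bold>\<in>D. \<^bold>\<exists>b\<^bold>\<in>D. is_triple t a b d \<^bold>\<and>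
        (\<^bold>\<forall>s\<^bold>\<in>A. pair_in d s F \<^bold>\<longleftrightarrow> (pair_in a s F \<^bold>\<longrightarrow> pair_in b s F))))
    \<^bold>\<or> (\<^bold>\<exists>t. is_num 4 t \<^bold>\<and> (\<^bold>\<exists>i\<^bold>\<in>I. \<^bold>\<exists>a\<^bold>\<in>D. is_triple t i a d \<^bold>\<and>
        (\<^bold>\<forall>s\<^bold>\<in>A. pair_in d s F \<^bold>\<longleftrightarrow>
          (\<^bold>\<forall>r\<^bold>\<in>A. (\<^bold>\<forall>j\<^bold>\<in>I. \<^bold>\<not> j \<^bold>= i \<^bold>\<longrightarrow> (\<^bold>\<exists>x\<^bold>\<in>M. pair_in j x s \<^bold>\<and> pair_in j x r))
            \<^bold>\<longrightarrow> pair_in a r F)))))"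

definition satisfies :: "nat \<Rightarrow> nat \<Rightarrow> nat \<Rightarrow> fm" where
  \<comment> \<open>\<open>(M, E)\<close> satisfies the formula coded by \<open>c\<close> under all assignments\<close>
  "satisfies M E c =
    (let I = fresh [M, E, c]; A = I + 1; D = I + 2; F = I + 3; s = I + 4 in
    ExSet I (ExSet A (ExSet D (ExSet F (
      (\<^bold>\<forall>s. s \<^bold>\<in> A \<^bold>\<longleftrightarrow> is_set s \<^bold>\<and> is_function s I M) \<^bold>\<and>
      tarski_clauses M E I A D F \<^bold>\<and>
      c \<^bold>\<in> D \<^bold>\<and> (\<^bold>\<forall>s\<^bold>\<in>A. pair_in c s F))))))"

text \<open>The sentence ``there exists a model of \<open>T\<close>'', for a list \<open>T\<close> of axioms.\<close>

definition exists_model :: "fm list \<Rightarrow> fm" where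
  "exists_model T = ExSet 0 (ExSet 1 (is_structure 0 1 \<^bold>\<and>
    foldr (\<lambda>\<phi> \<psi>. ExSet 2 (is_code \<phi> 2 \<^bold>\<and> satisfies 0 1 2) \<^bold>\<and> \<psi>) T (\<^bold>\<forall>2. 2 \<^bold>= 2)))"

end

theory Submission
  imports Defs "HOL-Library.Countable"
begin

text \<open>Suppose that \<open>T\<close> is consistent and proves that \<open>T\<close> has a model. By completeness, \<open>T\<close> has a
  model, and every model \<open>M\<close> of \<open>T\<close> contains an inner model: a set of \<open>M\<close> that \<open>M\<close> believes to be,
  and that therefore is, a model of \<open>T\<close>. By diagonalization there is a sentence that holds in \<open>M\<close>
  if and only if it fails in some inner model of \<open>M\<close>. If it fails in \<open>M\<close>, then it holds in
  some inner model \<open>N\<close>, hence fails in an inner model of \<open>N\<close>; but this is an inner model of \<open>M\<close>,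
  so the sentence holds in \<open>M\<close>. Thus it holds in all models of \<open>T\<close>, so fails in an inner model of
  one of them, which is absurd.

  Inner models are substructures on a subset of the same carrier, so an inner model of an inner
  model of \<open>M\<close> is literally an inner model of \<open>M\<close>, not just up to isomorphism.\<close>

section \<open>Satisfaction, soundness and completeness\<close>

text \<open>Provability is never formalized inside the theory, only truth in structures;
  completeness is used once, from outside, to get a first model. Two obstacles shape the rest.
  First, infinity, foundation and power set are not assumed and models may be nonstandard, so a
  model may contain objects that it takes for codes although no formula corresponds to them. Facts
  about internal satisfaction are therefore proved by induction on an actual formula, outside the
  model, and for each such formula the required part of a satisfaction relation is put together by
  bounded separation. Second, the diagonal formula refers to its own code, but in an inner model the
  code of the same formula is in general a different element, which the outer model has to find by
  means of a formula. Bisimulation takes the place of a recursion on codes here: the inner code is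
  the only element of the inner model that is bisimilar to the outer code.\<close>

primrec sat :: "'a set \<Rightarrow> ('a \<Rightarrow> 'a \<Rightarrow> bool) \<Rightarrow> (nat \<Rightarrow> 'a) \<Rightarrow> fm \<Rightarrow> bool" where
  "sat U R e (Mem x y) \<longleftrightarrow> R (e x) (e y)"
| "sat U R e (Eq x y) \<longleftrightarrow> e x = e y"
| "sat U R e (Neg \<phi>) \<longleftrightarrow> \<not> sat U R e \<phi>"
| "sat U R e (Imp \<phi> \<psi>) \<longleftrightarrow> (sat U R e \<phi> \<longrightarrow> sat U R e \<psi>)"
| "sat U R e (All x \<phi>) \<longleftrightarrow> (\<forall>a\<in>U. sat U R (e(x := a)) \<phi>)"

lemma sat_cong: "(\<And>x. x \<in> fv \<phi> \<Longrightarrow> e x = e' x) \<Longrightarrow> sat U R e \<phi> \<longleftrightarrow> sat U R e' \<phi>"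
proof (induction \<phi> arbitrary: e e')
  case (Imp \<phi> \<psi>)
  then show ?case by (metis UnCI fv.simps(4) sat.simps(4))
next
  case (All x \<phi>)
  have "sat U R (e(x := a)) \<phi> \<longleftrightarrow> sat U R (e'(x := a)) \<phi>" for a
    by (rule All.IH) (use All.prems in auto)
  then show ?case by simp
next
  case (Neg \<phi>)
  then show ?case by (metis fv.simps(3) sat.simps(3))
qed simp_all

lemma sat_sentence: "sentence \<phi> \<Longrightarrow> sat U R e \<phi> \<longleftrightarrow> sat U R e' \<phi>"
  by (rule sat_cong) (simp add: sentence_def)

lemma subst_not_free: "x \<notin> fv \<phi> \<Longrightarrow> subst x y \<phi> = \<phi>"
  by (induction \<phi>) auto

lemma sat_subst: "free_for y x \<phi> \<Longrightarrow> sat U R e (subst x y \<phi>) \<longleftrightarrow> sat U R (e(x := e y)) \<phi>"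
proof (induction \<phi> arbitrary: e)
  case (All z \<phi>)
  consider "z = x" | "z \<noteq> x" "x \<notin> fv \<phi>" | "z \<noteq> x" "z \<noteq> y" "free_for y x \<phi>"
    using All.prems by auto
  then show ?case
  proof cases
    \<comment> \<open>Here \<open>z = y\<close> is possible, so nothing forbids capture; but
      \<open>x\<close> is not free in \<open>\<phi>\<close> and the substitution changes
      nothing.\<close>
    case 2
    have "sat U R (e(z := a)) \<phi> \<longleftrightarrow> sat U R (e(x := e y, z := a)) \<phi>" for a
      by (rule sat_cong) (use 2 in auto)
    moreover have "subst x y (All z \<phi>) = All z \<phi>"
      using 2 by (simp add: subst_not_free)
    ultimately show ?thesis by (simp only: sat.simps)
  next
    case 3
    have "sat U R (e(z := a)) (subst x y \<phi>) \<longleftrightarrow> sat U R (e(x := e y, z := a)) \<phi>" for a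
    proof -
      have "(e(z := a))(x := (e(z := a)) y) = e(x := e y, z := a)" using 3 by auto
      then show ?thesis using All.IH[OF 3(3), of "e(z := a)"] by argo
    qed
    with 3 show ?thesis by (simp del: fun_upd_apply)
  qed (simp del: fun_upd_apply)
qed auto

text \<open>The values of \<open>e\<close> have to lie in the carrier because of
  \<open>Inst\<close>: its instance is evaluated at \<open>e y\<close>, which must be among the
  elements that the quantifier ranges over.\<close>

lemma sat_logical_axiom:
  assumes "logical_axiom \<phi>" "\<And>n. e n \<in> U"
  shows "sat U R e \<phi>"
  using assms
proof (induction arbitrary: e)
  case (Inst y x \<phi>)
  then show ?case by (simp add: sat_subst)
next
  case (Vacuous x \<phi>)
  have "sat U R e \<phi> \<longleftrightarrow> sat U R (e(x := a)) \<phi>" for a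
    by (rule sat_cong) (use Vacuous in auto)
  then show ?case by simp
next
  case (Gen \<phi> x)
  then show ?case by simp
next
  case (Contrapos \<phi> \<psi>)
  then show ?case unfolding sat.simps by blast
qed simp_all

theorem soundness:
  assumes "T \<turnstile> \<phi>" "\<And>\<psi> e. \<psi> \<in> T \<Longrightarrow> (\<And>n. e n \<in> U) \<Longrightarrow> sat U R e \<psi>" "\<And>n. e n \<in> U"
  shows "sat U R e \<phi>"
  using assms(1)
proof (induction rule: proves.induct)
  case (Logic \<phi>)
  then show ?case using assms(3) by (rule sat_logical_axiom)
next
  case (Assum \<phi>)
  then show ?case using assms(2,3) by blast
qed simp_all

section \<open>Derived rules of the Hilbert calculus\<close>

lemma proves_mono: "T \<turnstile> \<phi> \<Longrightarrow> T \<subseteq> T' \<Longrightarrow> T' \<turnstile> \<phi>"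
  by (induction rule: proves.induct) (auto intro: proves.intros)

lemma proves_imp_refl: "T \<turnstile> Imp \<phi> \<phi>"
proof -
  have "T \<turnstile> Imp (Imp \<phi> (Imp (Imp \<phi> \<phi>) \<phi>)) (Imp (Imp \<phi> (Imp \<phi> \<phi>)) (Imp \<phi> \<phi>))"
    by (rule Logic[OF S])
  then show ?thesis by (rule MP[OF MP[OF _ Logic[OF K]] Logic[OF K]])
qed

lemma proves_imp_K: "T \<turnstile> \<psi> \<Longrightarrow> T \<turnstile> Imp \<phi> \<psi>"
  by (rule MP[OF Logic[OF K]])

lemma deduction: "insert \<phi> T \<turnstile> \<psi> \<Longrightarrow> T \<turnstile> Imp \<phi> \<psi>"
proof (induction rule: proves.induct)
  case (Logic \<psi>)
  then show ?case by (intro proves_imp_K proves.Logic)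
next
  case (Assum \<psi>)
  then show ?case by (auto intro: proves_imp_refl proves_imp_K proves.Assum)
next
  case (MP \<psi> \<chi>)
  then show ?case by (blast intro: proves.MP[OF proves.MP[OF Logic[OF S]]])
qed

text \<open>The calculus has no rule of generalization. It is admissible because axioms are closed
  under \<open>Gen\<close>, \<open>Vacuous\<close> covers assumptions in which \<open>x\<close> is
  not free, and \<open>Distrib\<close> carries the quantifier through modus ponens.\<close>

lemma generalization: "T \<turnstile> \<phi> \<Longrightarrow> (\<And>\<psi>. \<psi> \<in> T \<Longrightarrow> x \<notin> fv \<psi>) \<Longrightarrow> T \<turnstile> All x \<phi>"
proof (induction rule: proves.induct)
  case (Assum \<psi>)
  then show ?case by (blast intro: proves.MP[OF Logic[OF Vacuous]] proves.Assum)
next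
  case (MP \<psi> \<chi>)
  then show ?case by (blast intro: proves.MP[OF proves.MP[OF Logic[OF Distrib]]])
qed (auto intro: Gen Logic)

lemma proves_explosion: "T \<turnstile> \<phi> \<Longrightarrow> T \<turnstile> Neg \<phi> \<Longrightarrow> T \<turnstile> \<psi>"
  by (rule MP[OF MP[OF Logic[OF Contrapos] proves_imp_K]])

lemma proves_by_contradiction:
  assumes "\<not> consistent (insert (Neg \<phi>) T)"
  shows "T \<turnstile> \<phi>"
proof -
  \<comment> \<open>\<open>Contrapos\<close> is the only axiom about negation, so the contradiction
    is turned into the negation of a theorem; \<open>Eq 0 0\<close> is one by
    \<open>Refl\<close>.\<close>
  let ?t = "Eq 0 0"
  have "insert (Neg \<phi>) T \<turnstile> Neg ?t"
    using assms proves_explosion unfolding consistent_def by blast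
  then have "T \<turnstile> Imp (Neg \<phi>) (Neg ?t)" by (rule deduction)
  then show ?thesis by (rule MP[OF MP[OF Logic[OF Contrapos]] Logic[OF Refl]])
qed

text \<open>Double negation has to be eliminated on the way: under the assumption
  \<open>Neg (Neg \<phi>)\<close> one derives \<open>\<phi>\<close>, and from it both halves of the
  given contradiction.\<close>

lemma proves_Neg:
  assumes "\<not> consistent (insert \<phi> T)"
  shows "T \<turnstile> Neg \<phi>"
proof (rule proves_by_contradiction)
  let ?T = "insert (Neg (Neg \<phi>)) T"
  have "\<not> consistent (insert (Neg \<phi>) ?T)"
    unfolding consistent_def by (auto intro!: exI[of _ "Neg \<phi>"] Assum)
  then have "?T \<turnstile> \<phi>" by (rule proves_by_contradiction)
  moreover from assms obtain \<psi> where "insert \<phi> T \<turnstile> \<psi>" "insert \<phi> T \<turnstile> Neg \<psi>"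
    unfolding consistent_def by blast
  then have "T \<turnstile> Imp \<phi> \<psi>" "T \<turnstile> Imp \<phi> (Neg \<psi>)" by (auto intro: deduction)
  then have "?T \<turnstile> Imp \<phi> \<psi>" "?T \<turnstile> Imp \<phi> (Neg \<psi>)" by (auto elim: proves_mono)
  ultimately show "\<not> consistent ?T"
    unfolding consistent_def by (blast intro: MP)
qed

section \<open>Bound variables and their renaming\<close>

primrec bv :: "fm \<Rightarrow> nat set" where
  "bv (Mem x y) = {}"
| "bv (Eq x y) = {}"
| "bv (Neg \<phi>) = bv \<phi>"
| "bv (Imp \<phi> \<psi>) = bv \<phi> \<union> bv \<psi>"
| "bv (All x \<phi>) = insert x (bv \<phi>)"

lemma finite_fv [simp]: "finite (fv \<phi>)"
  by (induction \<phi>) auto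

lemma finite_bv [simp]: "finite (bv \<phi>)"
  by (induction \<phi>) auto

lemma bv_subst [simp]: "bv (subst x y \<phi>) = bv \<phi>"
  by (induction \<phi>) auto

lemma size_subst [simp]: "size (subst x y \<phi>) = size \<phi>"
  by (induction \<phi>) auto

lemma fv_subst: "fv (subst x y \<phi>) \<subseteq> fv \<phi> - {x} \<union> {y}"
  by (induction \<phi>) auto

lemma free_for_not_bv: "y \<notin> bv \<phi> \<Longrightarrow> free_for y x \<phi>"
  by (induction \<phi>) auto

lemma subst_back: "y \<notin> fv \<phi> \<Longrightarrow> y \<notin> bv \<phi> \<Longrightarrow> subst y x (subst x y \<phi>) = \<phi>"
  by (induction \<phi>) (auto simp: subst_not_free)

lemma free_for_back: "y \<notin> fv \<phi> \<Longrightarrow> y \<notin> bv \<phi> \<Longrightarrow> free_for x y (subst x y \<phi>)"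
proof (induction \<phi>)
  case (All z \<phi>)
  then show ?case
    using fv_subst[of x y \<phi>] by (cases "z = x") auto
qed auto

text \<open>Instantiating at \<open>x\<close> undoes the substitution because \<open>y\<close> is
  new; the result can be generalized over \<open>x\<close>, which is no longer free in the
  assumption.\<close>

lemma rename_bound:
  assumes "y \<notin> fv \<phi>" "y \<notin> bv \<phi>" "y \<noteq> x"
  shows "T \<turnstile> Imp (All y (subst x y \<phi>)) (All x \<phi>)"
proof -
  have "{All y (subst x y \<phi>)} \<turnstile> subst y x (subst x y \<phi>)"
    by (intro MP[OF Logic[OF Inst]] Assum free_for_back assms singletonI)
  then have "{All y (subst x y \<phi>)} \<turnstile> \<phi>"
    using assms by (simp add: subst_back)
  then have "{All y (subst x y \<phi>)} \<turnstile> All x \<phi>"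
    by (rule generalization) (use fv_subst[of x y \<phi>] assms in auto)
  then have "{} \<turnstile> Imp (All y (subst x y \<phi>)) (All x \<phi>)"
    by (rule deduction)
  then show ?thesis by (rule proves_mono) simp
qed

text \<open>Henkin's step. If the witness led to a contradiction, the instance at \<open>y\<close>
  would be provable; as \<open>y\<close> is free in no assumption, it could be generalized and
  renamed to the very formula whose negation is assumed.\<close>

lemma consistent_witness:
  assumes "consistent (insert (Neg (All x \<phi>)) T)"
    and y: "\<And>\<psi>. \<psi> \<in> T \<Longrightarrow> y \<notin> fv \<psi>" "y \<notin> fv \<phi>" "y \<notin> bv \<phi>" "y \<noteq> x"
  shows "consistent (insert (Neg (subst x y \<phi>)) (insert (Neg (All x \<phi>)) T))"
proof (rule ccontr)
  let ?T = "insert (Neg (All x \<phi>)) T"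
  assume "\<not> ?thesis"
  then have "?T \<turnstile> subst x y \<phi>" by (rule proves_by_contradiction)
  then have "?T \<turnstile> All y (subst x y \<phi>)"
    by (rule generalization) (use y in auto)
  then have "?T \<turnstile> All x \<phi>"
    by (rule MP[OF rename_bound[OF y(2-4)]])
  moreover have "?T \<turnstile> Neg (All x \<phi>)" by (rule Assum) simp
  ultimately show False
    using assms(1) unfolding consistent_def by blast
qed

section \<open>Henkin completion\<close>

instance fm :: countable
  by countable_datatype

definition witness_var :: "nat \<Rightarrow> fm set \<Rightarrow> fm \<Rightarrow> nat" where
  "witness_var n T \<phi> = (SOME y. n \<le> y \<and> y \<notin> (\<Union>\<psi>\<in>insert \<phi> T. fv \<psi>) \<union> bv \<phi>)"

lemma witness_var:
  assumes "finite T"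
  shows "n \<le> witness_var n T \<phi>"
    and "witness_var n T \<phi> \<notin> (\<Union>\<psi>\<in>insert \<phi> T. fv \<psi>) \<union> bv \<phi>"
proof -
  have "finite ({..<n} \<union> (\<Union>\<psi>\<in>insert \<phi> T. fv \<psi>) \<union> bv \<phi>)" using assms by simp
  then obtain y where "y \<notin> {..<n} \<union> (\<Union>\<psi>\<in>insert \<phi> T. fv \<psi>) \<union> bv \<phi>"
    using ex_new_if_finite[OF infinite_UNIV_nat] by metis
  then have "n \<le> y \<and> y \<notin> (\<Union>\<psi>\<in>insert \<phi> T. fv \<psi>) \<union> bv \<phi>" by auto
  then have *: "n \<le> witness_var n T \<phi> \<and>
      witness_var n T \<phi> \<notin> (\<Union>\<psi>\<in>insert \<phi> T. fv \<psi>) \<union> bv \<phi>"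
    unfolding witness_var_def by (rule someI)
  show "n \<le> witness_var n T \<phi>" using * by (rule conjunct1)
  show "witness_var n T \<phi> \<notin> (\<Union>\<psi>\<in>insert \<phi> T. fv \<psi>) \<union> bv \<phi>"
    using * by (rule conjunct2)
qed

text \<open>A universal formula that is refused gets its counterexample in the same step, so a
  single pass over all formulas yields both completeness and witnesses.\<close>

definition decide :: "nat \<Rightarrow> fm \<Rightarrow> fm set \<Rightarrow> fm set" where
  "decide n \<phi> T =
    (if consistent (insert \<phi> T) then insert \<phi> T
     else insert (Neg \<phi>) T \<union>
       (case \<phi> of All x \<psi> \<Rightarrow> {Neg (subst x (witness_var n T \<phi>) \<psi>)} | _ \<Rightarrow> {}))"

lemma finite_decide: "finite T \<Longrightarrow> finite (decide n \<phi> T)"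
  by (auto simp: decide_def split: fm.split)

lemma decide_superset: "T \<subseteq> decide n \<phi> T"
  by (auto simp: decide_def split: fm.split)

lemma decide_decides: "\<phi> \<in> decide n \<phi> T \<or> Neg \<phi> \<in> decide n \<phi> T"
  by (auto simp: decide_def split: fm.split)

lemma decide_witness:
  assumes "finite T" "All x \<psi> \<notin> decide n (All x \<psi>) T"
  shows "\<exists>y\<ge>n. Neg (subst x y \<psi>) \<in> decide n (All x \<psi>) T"
  using assms witness_var(1)[OF assms(1)] by (auto simp: decide_def split: if_splits)

lemma consistent_decide:
  assumes "finite T" "consistent T"
  shows "consistent (decide n \<phi> T)"
proof (cases "consistent (insert \<phi> T)")
  case True
  then show ?thesis by (simp add: decide_def)
next
  case False
  have c: "consistent (insert (Neg \<phi>) T)"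
    using proves_by_contradiction proves_Neg[OF False] assms(2) unfolding consistent_def by blast
  show ?thesis
  proof (cases "\<exists>x \<psi>. \<phi> = All x \<psi>")
    case True
    then obtain x \<psi> where \<phi>: "\<phi> = All x \<psi>" by blast
    let ?y = "witness_var n T \<phi>"
    have y: "?y \<notin> (\<Union>\<chi>\<in>insert \<phi> T. fv \<chi>) \<union> bv \<phi>" using assms(1) by (rule witness_var)
    have "consistent (insert (Neg (subst x ?y \<psi>)) (insert (Neg (All x \<psi>)) T))"
      by (rule consistent_witness) (use c y \<phi> in auto)
    with False show ?thesis by (simp add: decide_def \<phi>)
  next
    case False
    with c \<open>\<not> consistent (insert \<phi> T)\<close> show ?thesis
      by (auto simp: decide_def split: fm.split)
  qed
qed

lemma proves_chain:
  fixes G :: "nat \<Rightarrow> fm set"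
  assumes "(\<Union>k. G k) \<turnstile> \<phi>" "mono G"
  shows "\<exists>k. G k \<turnstile> \<phi>"
  using assms(1)
proof (induction rule: proves.induct)
  case (MP \<phi> \<psi>)
  then obtain i j where "G i \<turnstile> Imp \<phi> \<psi>" "G j \<turnstile> \<phi>" by blast
  then have "G (max i j) \<turnstile> Imp \<phi> \<psi>" "G (max i j) \<turnstile> \<phi>"
    using monoD[OF assms(2)] by (meson max.cobounded1 max.cobounded2 proves_mono)+
  then show ?case by (blast intro: proves.MP)
qed (auto intro: Logic Assum)

lemma henkin_extension:
  assumes "finite T" "consistent T"
  obtains \<Gamma> where "T \<subseteq> \<Gamma>" "consistent \<Gamma>" "\<And>\<phi>. \<phi> \<in> \<Gamma> \<or> Neg \<phi> \<in> \<Gamma>"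
    and "\<And>x \<psi>. All x \<psi> \<notin> \<Gamma> \<Longrightarrow> \<exists>y\<ge>n. Neg (subst x y \<psi>) \<in> \<Gamma>"
proof -
  define G where "G = rec_nat T (\<lambda>k. decide n (from_nat k))"
  have G0: "G 0 = T" and GS: "G (Suc k) = decide n (from_nat k) (G k)" for k
    by (simp_all add: G_def)
  have fc: "finite (G k) \<and> consistent (G k)" for k
    by (induction k) (simp_all add: G0 GS assms finite_decide consistent_decide)
  have mono: "mono G"
    by (rule mono_iff_le_Suc[THEN iffD2]) (simp add: GS decide_superset)
  have sub: "G k \<subseteq> (\<Union>k. G k)" for k by blast
  show thesis
  proof (rule that[of "\<Union>k. G k"])
    show "T \<subseteq> (\<Union>k. G k)" using sub[of 0] by (simp add: G0)
    show "consistent (\<Union>k. G k)"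
      unfolding consistent_def
    proof (rule notI, elim exE conjE)
      fix \<phi> assume "(\<Union>k. G k) \<turnstile> \<phi>" "(\<Union>k. G k) \<turnstile> Neg \<phi>"
      then obtain i j where "G i \<turnstile> \<phi>" "G j \<turnstile> Neg \<phi>" using proves_chain mono by blast
      then have "G (max i j) \<turnstile> \<phi>" "G (max i j) \<turnstile> Neg \<phi>"
        using monoD[OF mono] by (meson max.cobounded1 max.cobounded2 proves_mono)+
      then show False using fc unfolding consistent_def by blast
    qed
    show "\<phi> \<in> (\<Union>k. G k) \<or> Neg \<phi> \<in> (\<Union>k. G k)" for \<phi>
      using decide_decides[of \<phi> n "G (to_nat \<phi>)"] sub[of "Suc (to_nat \<phi>)"] by (auto simp: GS)
    show "\<exists>y\<ge>n. Neg (subst x y \<psi>) \<in> (\<Union>k. G k)" if "All x \<psi> \<notin> (\<Union>k. G k)" for x \<psi>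
    proof -
      let ?k = "to_nat (All x \<psi>)"
      have "G (Suc ?k) = decide n (All x \<psi>) (G ?k)" by (simp add: GS)
      then show ?thesis
        using decide_witness[of "G ?k" x \<psi> n] fc that sub[of "Suc ?k"] by fastforce
    qed
  qed
qed

text \<open>The witnesses for universal formulas are variables \<open>\<ge> n\<close>, where \<open>n\<close> exceeds all bound
  variables of \<open>T\<close>, so instantiating them never captures. The model consists of the least
  representatives of these variables modulo provable equality.\<close>

theorem model_existence:
  assumes "finite T" "consistent T" "\<forall>\<phi>\<in>T. sentence \<phi>"
  obtains U :: "nat set" and R where "U \<noteq> {}" "\<And>a b. R a b \<Longrightarrow> a \<in> U \<and> b \<in> U"
    and "\<And>\<phi> e. \<phi> \<in> T \<Longrightarrow> sat U R e \<phi>"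
proof -
  have "finite (\<Union>\<phi>\<in>T. bv \<phi>)" using assms(1) by simp
  then obtain n where n: "(\<Union>\<phi>\<in>T. bv \<phi>) \<subseteq> {..<n}"
    unfolding finite_nat_set_iff_bounded by blast
  obtain \<Gamma> where \<Gamma>: "T \<subseteq> \<Gamma>" "consistent \<Gamma>" "\<And>\<phi>. \<phi> \<in> \<Gamma> \<or> Neg \<phi> \<in> \<Gamma>"
    and wit: "\<And>x \<psi>. All x \<psi> \<notin> \<Gamma> \<Longrightarrow> \<exists>y\<ge>n. Neg (subst x y \<psi>) \<in> \<Gamma>"
    using henkin_extension[OF assms(1,2)] by blast
  have closed: "\<phi> \<in> \<Gamma>" if "\<Gamma> \<turnstile> \<phi>" for \<phi>
    using that \<Gamma>(2) \<Gamma>(3)[of \<phi>] Assum unfolding consistent_def by blast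
  have Neg: "Neg \<phi> \<in> \<Gamma> \<longleftrightarrow> \<phi> \<notin> \<Gamma>" for \<phi>
    using \<Gamma>(2) \<Gamma>(3)[of \<phi>] Assum unfolding consistent_def by blast
  have mp: "\<psi> \<in> \<Gamma>" if "Imp \<phi> \<psi> \<in> \<Gamma>" "\<phi> \<in> \<Gamma>" for \<phi> \<psi>
    by (rule closed[OF MP[OF Assum[OF that(1)] Assum[OF that(2)]]])
  have ax: "\<phi> \<in> \<Gamma>" if "logical_axiom \<phi>" for \<phi>
    by (rule closed[OF Logic[OF that]])
  have Imp: "Imp \<phi> \<psi> \<in> \<Gamma> \<longleftrightarrow> (\<phi> \<in> \<Gamma> \<longrightarrow> \<psi> \<in> \<Gamma>)" for \<phi> \<psi>
  proof
    assume "\<phi> \<in> \<Gamma> \<longrightarrow> \<psi> \<in> \<Gamma>"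
    then show "Imp \<phi> \<psi> \<in> \<Gamma>"
    proof (cases "\<psi> \<in> \<Gamma>")
      case True
      then show ?thesis by (rule closed[OF proves_imp_K[OF Assum]])
    next
      case False
      with \<open>\<phi> \<in> \<Gamma> \<longrightarrow> \<psi> \<in> \<Gamma>\<close> have "Neg \<phi> \<in> \<Gamma>" by (simp add: Neg)
      then have "insert \<phi> \<Gamma> \<turnstile> \<phi>" "insert \<phi> \<Gamma> \<turnstile> Neg \<phi>" by (auto intro: Assum)
      then have "insert \<phi> \<Gamma> \<turnstile> \<psi>" by (rule proves_explosion)
      then show ?thesis by (rule closed[OF deduction])
    qed
  qed (use mp in blast)
  have eq_refl: "Eq y y \<in> \<Gamma>" for y by (rule ax[OF Refl])
  have eq_sym: "Eq y x \<in> \<Gamma>" if "Eq x y \<in> \<Gamma>" for x y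
    using mp[OF mp[OF ax[OF Eq_Eq] that] eq_refl] .
  have eq_trans: "Eq x z \<in> \<Gamma>" if "Eq x y \<in> \<Gamma>" "Eq y z \<in> \<Gamma>" for x y z
    using mp[OF mp[OF ax[OF Eq_Eq] eq_sym[OF that(1)]] that(2)] .
  define rep where "rep x = (LEAST y. n \<le> y \<and> Eq x y \<in> \<Gamma>)" for x
  have rep: "n \<le> rep x \<and> Eq x (rep x) \<in> \<Gamma>" if "n \<le> x" for x
    unfolding rep_def by (rule LeastI[of _ x]) (simp add: that eq_refl)
  have rep_eq: "rep x = rep y \<longleftrightarrow> Eq x y \<in> \<Gamma>" if "n \<le> x" "n \<le> y" for x y
  proof
    assume "rep x = rep y"
    then show "Eq x y \<in> \<Gamma>" using rep[OF that(1)] rep[OF that(2)] eq_sym eq_trans by metis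
  next
    assume "Eq x y \<in> \<Gamma>"
    then have "Eq x z \<in> \<Gamma> \<longleftrightarrow> Eq y z \<in> \<Gamma>" for z by (metis eq_sym eq_trans)
    then show "rep x = rep y" by (simp add: rep_def)
  qed
  have rep_rep: "rep (rep x) = rep x" if "n \<le> x" for x
    using rep[OF that] rep_eq that eq_sym by blast
  define U where "U = rep ` {n..}"
  define R where "R a b \<longleftrightarrow> a \<in> U \<and> b \<in> U \<and> Mem a b \<in> \<Gamma>" for a b
  have mem: "R (rep x) (rep y) \<longleftrightarrow> Mem x y \<in> \<Gamma>" if "n \<le> x" "n \<le> y" for x y
  proof -
    have *: "Mem x' y' \<in> \<Gamma>" if "Mem x y \<in> \<Gamma>" "Eq x x' \<in> \<Gamma>" "Eq y y' \<in> \<Gamma>" for x y x' y'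
    proof -
      have "Mem x' y \<in> \<Gamma>" using mp[OF mp[OF ax[OF Eq_Mem_left] that(2)] that(1)] .
      with mp[OF mp[OF ax[OF Eq_Mem_right] that(3)]] show ?thesis .
    qed
    show ?thesis
      using *[of x y "rep x" "rep y"] *[of "rep x" "rep y" x y] rep[OF that(1)] rep[OF that(2)] that eq_sym
      by (auto simp: R_def U_def)
  qed
  \<comment> \<open>The induction is on size, since an instance of a quantified formula need not be
    a subformula. Instantiating at a variable from \<open>n\<close> on preserves both side
    conditions.\<close>
  have truth: "sat U R rep \<phi> \<longleftrightarrow> \<phi> \<in> \<Gamma>" if "bv \<phi> \<subseteq> {..<n}" "fv \<phi> \<subseteq> {n..}" for \<phi>
    using that
  proof (induction "size \<phi>" arbitrary: \<phi> rule: less_induct)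
    case less
    show ?case
    proof (cases \<phi>)
      case (Mem x y)
      with less.prems mem show ?thesis by simp
    next
      case (Eq x y)
      with less.prems rep_eq show ?thesis by simp
    next
      case (Neg \<psi>)
      with less show ?thesis by (simp add: \<open>\<And>\<phi>. Neg \<phi> \<in> \<Gamma> \<longleftrightarrow> \<phi> \<notin> \<Gamma>\<close>)
    next
      case (Imp \<psi> \<chi>)
      with less show ?thesis
        by (simp add: \<open>\<And>\<phi> \<psi>. Imp \<phi> \<psi> \<in> \<Gamma> \<longleftrightarrow> (\<phi> \<in> \<Gamma> \<longrightarrow> \<psi> \<in> \<Gamma>)\<close>)
    next
      case (All x \<psi>)
      have ff: "free_for y x \<psi>" if "n \<le> y" for y
        by (rule free_for_not_bv) (use less.prems(1) All that in auto)
      have inst: "sat U R (rep(x := rep y)) \<psi> \<longleftrightarrow> subst x y \<psi> \<in> \<Gamma>" if "n \<le> y" for y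
      proof -
        have "sat U R rep (subst x y \<psi>) \<longleftrightarrow> subst x y \<psi> \<in> \<Gamma>"
          by (rule less.hyps) (use less.prems All that fv_subst[of x y \<psi>] in auto)
        then show ?thesis using sat_subst[OF ff[OF that]] by blast
      qed
      have "sat U R rep \<phi> \<longleftrightarrow> (\<forall>y\<ge>n. subst x y \<psi> \<in> \<Gamma>)"
        using inst by (auto simp: All U_def)
      also have "\<dots> \<longleftrightarrow> \<phi> \<in> \<Gamma>"
        using wit[of x \<psi>] Neg mp[OF ax[OF Inst[OF ff]]] unfolding All by blast
      finally show ?thesis .
    qed
  qed
  show thesis
  proof (rule that)
    show "U \<noteq> {}" by (auto simp: U_def)
    show "a \<in> U \<and> b \<in> U" if "R a b" for a b using that by (simp add: R_def)
    show "sat U R e \<phi>" if "\<phi> \<in> T" for \<phi> e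
    proof -
      have s: "sentence \<phi>" using assms(3) that by blast
      then have "sat U R rep \<phi>"
        using truth[of \<phi>] n that \<Gamma>(1) by (auto simp: sentence_def)
      then show ?thesis using sat_sentence[OF s] by blast
    qed
  qed
qed

section \<open>Models of the basic axioms\<close>

text \<open>As \<open>R\<close> is confined to \<open>U\<close>, bounded quantifiers and the notion
  of set can be evaluated without mentioning the carrier.\<close>

locale model =
  fixes U :: "'a set" and R :: "'a \<Rightarrow> 'a \<Rightarrow> bool"
  assumes nonempty: "U \<noteq> {}"
    and field: "R a b \<Longrightarrow> a \<in> U \<and> b \<in> U"
begin

definition S :: "'a \<Rightarrow> bool" where
  "S x \<longleftrightarrow> (\<exists>y. R x y)"

lemma S_I: "R x y \<Longrightarrow> S x"
  by (auto simp: S_def)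

lemma S_U: "S x \<Longrightarrow> x \<in> U"
  by (auto simp: S_def field)

abbreviation "holds \<equiv> sat U R"

lemma holds_connectives [simp]:
  "holds e (Conj \<phi> \<psi>) \<longleftrightarrow> holds e \<phi> \<and> holds e \<psi>"
  "holds e (Disj \<phi> \<psi>) \<longleftrightarrow> holds e \<phi> \<or> holds e \<psi>"
  "holds e (Iff \<phi> \<psi>) \<longleftrightarrow> (holds e \<phi> \<longleftrightarrow> holds e \<psi>)"
  "holds e (Exists x \<phi>) \<longleftrightarrow> (\<exists>a\<in>U. holds (e(x := a)) \<phi>)"
  by (auto simp: Conj_def Disj_def Iff_def Exists_def)

lemma holds_AllIn [simp]:
  "x \<noteq> y \<Longrightarrow> holds e (AllIn x y \<phi>) \<longleftrightarrow> (\<forall>a. R a (e y) \<longrightarrow> holds (e(x := a)) \<phi>)"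
  using field by (auto simp: AllIn_def)

lemma holds_ExIn [simp]:
  "x \<noteq> y \<Longrightarrow> holds e (ExIn x y \<phi>) \<longleftrightarrow> (\<exists>a. R a (e y) \<and> holds (e(x := a)) \<phi>)"
  by (auto simp: ExIn_def)

lemma holds_is_set [simp]: "holds e (is_set x) \<longleftrightarrow> S (e x)"
  using field by (auto simp: is_set_def fresh_def S_def)

lemma holds_set_quantifiers [simp]:
  "holds e (AllSet x \<phi>) \<longleftrightarrow> (\<forall>a. S a \<longrightarrow> holds (e(x := a)) \<phi>)"
  "holds e (ExSet x \<phi>) \<longleftrightarrow> (\<exists>a. S a \<and> holds (e(x := a)) \<phi>)"
  using S_U by (auto simp: AllSet_def ExSet_def)

lemma holds_foldr_AllSet:
  assumes "holds e (foldr AllSet ps \<phi>)" "\<forall>n\<in>set ps. S (e' n)" "\<forall>n. n \<notin> set ps \<longrightarrow> e' n = e n"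
  shows "holds e' \<phi>"
  using assms
proof (induction ps arbitrary: e)
  case Nil
  then have "e' = e" by auto
  with Nil show ?case by simp
next
  case (Cons p ps)
  have "\<forall>a. S a \<longrightarrow> holds (e(p := a)) (foldr AllSet ps \<phi>)"
    using Cons.prems(1) by simp
  then have "holds (e(p := e' p)) (foldr AllSet ps \<phi>)"
    using Cons.prems(2) by fastforce
  then show ?case
    by (rule Cons.IH) (use Cons.prems(2,3) in auto)
qed

definition is_ext :: "('a \<Rightarrow> bool) \<Rightarrow> bool" where
  "is_ext P \<longleftrightarrow> (\<exists>z. S z \<and> (\<forall>w. R w z \<longleftrightarrow> P w))"

text \<open>Choice makes this a total operation, available before any axiom is assumed. Hence
  \<open>num\<close> and \<open>code\<close> are defined from \<open>R\<close> alone, and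
  \<open>refutes_diagonal\<close> can speak of the code in an arbitrary structure.\<close>

definition coll :: "('a \<Rightarrow> bool) \<Rightarrow> 'a" where
  "coll P = (SOME z. S z \<and> (\<forall>w. R w z \<longleftrightarrow> P w))"

lemma coll: "is_ext P \<Longrightarrow> S (coll P)" "is_ext P \<Longrightarrow> R w (coll P) \<longleftrightarrow> P w"
proof -
  assume "is_ext P"
  then have "S (coll P) \<and> (\<forall>w. R w (coll P) \<longleftrightarrow> P w)"
    unfolding is_ext_def coll_def by (rule someI_ex)
  then show "S (coll P)" "R w (coll P) \<longleftrightarrow> P w" by auto
qed

lemma is_ext_cong: "is_ext P \<Longrightarrow> (\<And>w. P w \<longleftrightarrow> Q w) \<Longrightarrow> is_ext Q"
  by (simp add: is_ext_def)

definition upair :: "'a \<Rightarrow> 'a \<Rightarrow> 'a" where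
  "upair x y = coll (\<lambda>w. w = x \<or> w = y)"

definition pair :: "'a \<Rightarrow> 'a \<Rightarrow> 'a" where
  "pair x y = upair (upair x x) (upair x y)"

definition un :: "'a \<Rightarrow> 'a \<Rightarrow> 'a" where
  "un x y = coll (\<lambda>w. R w x \<or> R w y)"

definition prod :: "'a \<Rightarrow> 'a \<Rightarrow> 'a" where
  "prod x y = coll (\<lambda>p. \<exists>u v. R u x \<and> R v y \<and> p = pair u v)"

primrec num :: "nat \<Rightarrow> 'a" where
  "num 0 = coll (\<lambda>_. False)"
| "num (Suc n) = un (num n) (upair (num n) (num n))"

primrec code :: "fm \<Rightarrow> 'a" where
  "code (Mem x y) = pair (num 0) (pair (num x) (num y))"
| "code (Eq x y) = pair (num 1) (pair (num x) (num y))"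
| "code (Neg \<phi>) = pair (num 2) (code \<phi>)"
| "code (Imp \<phi> \<psi>) = pair (num 3) (pair (code \<phi>) (code \<psi>))"
| "code (All x \<phi>) = pair (num 4) (pair (num x) (code \<phi>))"

end

section \<open>Pairs, numerals and codes in a model\<close>

locale basic_model = model +
  assumes basic: "\<phi> \<in> basic_axioms \<Longrightarrow> (\<And>n. e n \<in> U) \<Longrightarrow> sat U R e \<phi>"
begin

lemma extensionality:
  assumes "a \<in> U" "b \<in> U" "\<And>w. R w a \<longleftrightarrow> R w b"
  shows "a = b"
proof -
  have "holds (\<lambda>_. a) Extensionality_axiom"
    by (rule basic[OF basic_axioms.intros(1)]) (simp add: assms)
  then show ?thesis using assms by (simp add: Extensionality_axiom_def)
qed

lemma S_ext: "S a \<Longrightarrow> S b \<Longrightarrow> (\<And>w. R w a \<longleftrightarrow> R w b) \<Longrightarrow> a = b"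
  by (rule extensionality) (auto dest: S_U)

lemma coll_eq: "is_ext P \<Longrightarrow> z = coll P \<longleftrightarrow> z \<in> U \<and> (\<forall>w. R w z \<longleftrightarrow> P w)"
  using coll S_U extensionality by metis

lemma is_ext_empty: "is_ext (\<lambda>_. False)"
proof -
  obtain a where a: "a \<in> U" using nonempty by blast
  have "holds (\<lambda>_. a) Empty_set_axiom"
    by (rule basic[OF basic_axioms.intros(2)]) (simp add: a)
  then have "\<exists>z. S z \<and> (\<forall>w\<in>U. \<not> R w z)"
    by (simp add: Empty_set_axiom_def is_empty_def fresh_def)
  then show ?thesis
    using field by (auto simp: is_ext_def)
qed

lemma S_num_0: "S (num 0)"
  using coll(1)[OF is_ext_empty] by (simp only: num.simps)

lemma R_num_0 [simp]: "\<not> R w (num 0)"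
  using coll(2)[OF is_ext_empty] by (simp only: num.simps simp_thms)

lemma num_0_in_U: "num 0 \<in> U"
  by (rule S_U[OF S_num_0])

lemma is_ext_upair: "S x \<Longrightarrow> S y \<Longrightarrow> is_ext (\<lambda>w. w = x \<or> w = y)"
proof -
  assume "S x" "S y"
  have "holds (\<lambda>_. num 0) Pairing_axiom"
    by (rule basic[OF basic_axioms.intros(3)]) (rule num_0_in_U)
  then have "\<exists>z. S z \<and> (\<forall>w\<in>U. R w z \<longleftrightarrow> w = x \<or> w = y)"
    using \<open>S x\<close> \<open>S y\<close> by (simp add: Pairing_axiom_def is_upair_def fresh_def)
  then show ?thesis
    using field S_U \<open>S x\<close> \<open>S y\<close> unfolding is_ext_def by metis
qed

lemma S_upair [simp]: "S x \<Longrightarrow> S y \<Longrightarrow> S (upair x y)"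
  and R_upair [simp]: "S x \<Longrightarrow> S y \<Longrightarrow> R w (upair x y) \<longleftrightarrow> w = x \<or> w = y"
  using coll[OF is_ext_upair] by (auto simp: upair_def)

lemma S_pair [simp]: "S x \<Longrightarrow> S y \<Longrightarrow> S (pair x y)"
  by (simp add: pair_def)

lemma upair_inject:
  assumes "S x" "S y" "S x'" "S y'"
  shows "upair x y = upair x' y' \<longleftrightarrow> x = x' \<and> y = y' \<or> x = y' \<and> y = x'"
proof
  assume "upair x y = upair x' y'"
  then have "w = x \<or> w = y \<longleftrightarrow> w = x' \<or> w = y'" for w
    using R_upair[of x y] R_upair[of x' y'] assms by metis
  then show "x = x' \<and> y = y' \<or> x = y' \<and> y = x'" by metis
next
  assume "x = x' \<and> y = y' \<or> x = y' \<and> y = x'"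
  moreover have "upair x y = upair y x" by (simp add: upair_def disj_commute)
  ultimately show "upair x y = upair x' y'" by auto
qed

lemma pair_inject [simp]:
  assumes "S x" "S y" "S x'" "S y'"
  shows "pair x y = pair x' y' \<longleftrightarrow> x = x' \<and> y = y'"
  unfolding pair_def using assms by (auto simp: upair_inject)

lemma is_ext_Un:
  assumes "S x" "S y"
  shows "is_ext (\<lambda>w. R w x \<or> R w y)"
proof -
  have "holds (\<lambda>_. num 0) Union_axiom"
    by (rule basic[OF basic_axioms.intros(4)]) (rule num_0_in_U)
  then obtain z where z: "S z" "\<forall>w\<in>U. R w z \<longleftrightarrow> (\<exists>v. R v (upair x y) \<and> R w v)"
    using S_upair[OF assms] by (auto simp: Union_axiom_def)
  have "R w z \<longleftrightarrow> R w x \<or> R w y" for w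
    using z(2) assms field by (cases "w \<in> U") auto
  with z(1) show ?thesis by (auto simp: is_ext_def)
qed

lemma S_un [simp]: "S x \<Longrightarrow> S y \<Longrightarrow> S (un x y)"
  and R_un [simp]: "S x \<Longrightarrow> S y \<Longrightarrow> R w (un x y) \<longleftrightarrow> R w x \<or> R w y"
  using coll[OF is_ext_Un] by (auto simp: un_def)

lemma is_ext_Union:
  assumes "S x"
  shows "is_ext (\<lambda>w. \<exists>v. R v x \<and> R w v)"
proof -
  have "holds (\<lambda>_. num 0) Union_axiom"
    by (rule basic[OF basic_axioms.intros(4)]) (rule num_0_in_U)
  then obtain z where z: "S z" "\<forall>w\<in>U. R w z \<longleftrightarrow> (\<exists>v. R v x \<and> R w v)"
    using assms by (auto simp: Union_axiom_def)
  have "R w z \<longleftrightarrow> (\<exists>v. R v x \<and> R w v)" for w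
    using z(2) assms field by (cases "w \<in> U") auto
  with z(1) show ?thesis by (auto simp: is_ext_def)
qed

lemma S_num [simp]: "S (num n)"
  by (induction n) (use S_num_0 in auto)

lemma R_num: "R w (num n) \<longleftrightarrow> (\<exists>k<n. w = num k)"
proof (induction n)
  case 0
  show ?case using R_num_0 by simp
next
  case (Suc n)
  then show ?case by (auto simp: less_Suc_eq)
qed

text \<open>The model need not satisfy foundation, so distinct numerals are told apart by the number of
  their elements.\<close>

lemma num_distinct: "j < n \<Longrightarrow> num j \<noteq> num n"
proof (induction n arbitrary: j rule: less_induct)
  case (less n)
  have "card {w. R w (num k)} = k" if "k \<le> n" for k
  proof -
    have "{w. R w (num k)} = num ` {..<k}" by (auto simp: R_num)
    moreover have "inj_on num {..<k}"
      using less.IH that by (intro linorder_inj_onI') auto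
    ultimately show ?thesis by (simp add: card_image)
  qed
  from this[of j] this[of n] less.prems show ?case by auto
qed

lemma num_inject [simp]: "num j = num n \<longleftrightarrow> j = n"
  using num_distinct[of j n] num_distinct[of n j] by (cases j n rule: linorder_cases) auto

declare num.simps [simp del]

lemma num_Suc: "num (Suc n) = un (num n) (upair (num n) (num n))"
  by (rule num.simps)

lemma S_code [simp]: "S (code \<phi>)"
  by (induction \<phi>) simp_all

text \<open>Unique readability inside the model. It allows \<open>good_exists\<close> to read off
  from a pair in \<open>F\<close> which formula the pair is about.\<close>

lemma code_inject [simp]: "code \<phi> = code \<psi> \<longleftrightarrow> \<phi> = \<psi>"
  by (induction \<phi> arbitrary: \<psi>; case_tac \<psi>; simp)

lemma upair_eq: "S x \<Longrightarrow> S y \<Longrightarrow> z = upair x y \<longleftrightarrow> z \<in> U \<and> (\<forall>w. R w z \<longleftrightarrow> w = x \<or> w = y)"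
  unfolding upair_def by (rule coll_eq[OF is_ext_upair])

lemma holds_is_upair [simp]:
  assumes "S (e x)" "S (e y)" "e z \<in> U"
  shows "holds e (is_upair x y z) \<longleftrightarrow> e z = upair (e x) (e y)"
  unfolding upair_eq[OF assms(1,2)]
  using assms field S_U by (auto simp: is_upair_def fresh_def)

text \<open>\<open>S (e x)\<close> is needed: if \<open>e x\<close> is not a set then \<open>is_pair\<close> holds of the empty set.\<close>

lemma holds_is_pair [simp]:
  assumes "S (e x)" "S (e y)" "e z \<in> U"
  shows "holds e (is_pair x y z) \<longleftrightarrow> e z = pair (e x) (e y)"
proof -
  have "holds e (is_pair x y z) \<longleftrightarrow>
      (\<forall>w\<in>U. R w (e z) \<longleftrightarrow> w = upair (e x) (e x) \<or> w = upair (e x) (e y))"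
    using assms by (simp add: is_pair_def fresh_def)
  also have "\<dots> \<longleftrightarrow> (\<forall>w. R w (e z) \<longleftrightarrow> w = upair (e x) (e x) \<or> w = upair (e x) (e y))"
    using field S_U[OF S_upair] assms by blast
  finally show ?thesis using assms by (simp add: pair_def upair_eq)
qed

lemma holds_pair_in [simp]:
  assumes "S (e x)" "S (e y)"
  shows "holds e (pair_in x y r) \<longleftrightarrow> R (pair (e x) (e y)) (e r)"
proof -
  have "holds e (pair_in x y r) \<longleftrightarrow> (\<exists>p. R p (e r) \<and> p = pair (e x) (e y))"
    using assms field by (simp add: pair_in_def fresh_def cong: conj_cong)
  then show ?thesis by simp
qed

lemma holds_is_triple [simp]:
  assumes "S (e x)" "S (e y)" "S (e z)" "e d \<in> U"
  shows "holds e (is_triple x y z d) \<longleftrightarrow> e d = pair (e x) (pair (e y) (e z))"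
proof -
  have "holds e (is_triple x y z d) \<longleftrightarrow> (\<exists>p\<in>U. p = pair (e y) (e z) \<and> e d = pair (e x) p)"
    using assms by (simp add: is_triple_def fresh_def cong: conj_cong)
  then show ?thesis using assms S_U[OF S_pair] by auto
qed

lemma holds_is_succ:
  assumes "S (e x)" "e y \<in> U"
  shows "holds e (is_succ x y) \<longleftrightarrow> e y = un (e x) (upair (e x) (e x))"
proof -
  have "holds e (is_succ x y) \<longleftrightarrow> (\<forall>w. R w (e y) \<longleftrightarrow> R w (e x) \<or> w = e x)"
    using assms field S_U by (auto simp: is_succ_def fresh_def)
  also have "\<dots> \<longleftrightarrow> (\<forall>w. R w (e y) \<longleftrightarrow> R w (un (e x) (upair (e x) (e x))))"
    using assms by simp
  also have "\<dots> \<longleftrightarrow> e y = un (e x) (upair (e x) (e x))"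
    using extensionality assms S_U by (metis S_un S_upair)
  finally show ?thesis .
qed

lemma holds_is_num [simp]: "e x \<in> U \<Longrightarrow> holds e (is_num n x) \<longleftrightarrow> e x = num n"
proof (induction n arbitrary: e x)
  case 0
  have "holds e (is_num 0 x) \<longleftrightarrow> (\<forall>w. R w (e x) \<longleftrightarrow> R w (num 0))"
    using field by (auto simp: is_empty_def fresh_def)
  also have "\<dots> \<longleftrightarrow> e x = num 0"
    using extensionality[OF 0 num_0_in_U] by auto
  finally show ?case .
next
  case (Suc n)
  then have "holds e (is_num (Suc n) x) \<longleftrightarrow>
      (\<exists>a\<in>U. a = num n \<and> e x = un a (upair a a))"
    by (auto simp: fresh_def holds_is_succ)
  then show ?case using S_U[OF S_num] by (simp add: num.simps)
qed

declare is_num.simps [simp del]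

lemma num_in_U [simp]: "num n \<in> U"
  by (rule S_U[OF S_num])

lemma code_in_U [simp]: "code \<phi> \<in> U"
  by (rule S_U[OF S_code])

lemma holds_is_code [simp]: "e d \<in> U \<Longrightarrow> holds e (is_code \<phi> d) \<longleftrightarrow> e d = code \<phi>"
  by (induction \<phi> arbitrary: e d) (simp_all add: Let_def fresh_def cong: conj_cong)

end

section \<open>Bounded separation and families in a model\<close>

lemma bounded_connectives [simp, intro]:
  "bounded (Mem x y)"
  "bounded (Eq x y)"
  "bounded \<phi> \<Longrightarrow> bounded (Neg \<phi>)"
  "bounded \<phi> \<Longrightarrow> bounded \<psi> \<Longrightarrow> bounded (Imp \<phi> \<psi>)"
  "bounded \<phi> \<Longrightarrow> bounded \<psi> \<Longrightarrow> bounded (Conj \<phi> \<psi>)"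
  "bounded \<phi> \<Longrightarrow> bounded \<psi> \<Longrightarrow> bounded (Disj \<phi> \<psi>)"
  "bounded \<phi> \<Longrightarrow> bounded \<psi> \<Longrightarrow> bounded (Iff \<phi> \<psi>)"
  "x \<noteq> y \<Longrightarrow> bounded \<phi> \<Longrightarrow> bounded (AllIn x y \<phi>)"
  "x \<noteq> y \<Longrightarrow> bounded \<phi> \<Longrightarrow> bounded (ExIn x y \<phi>)"
  by (simp_all add: Conj_def Disj_def Iff_def ExIn_def bounded.intros)

text \<open>\<open>is_upair\<close> and \<open>is_pair\<close> quantify over all objects, so they
  cannot occur in the bounded formulas that separation admits; these are their bounded
  counterparts.\<close>

definition bounded_upair :: "nat \<Rightarrow> nat \<Rightarrow> nat \<Rightarrow> fm" where
  "bounded_upair x y z = (let w = fresh [x, y, z] in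
    Conj (Mem x z) (Conj (Mem y z) (AllIn w z (Disj (Eq w x) (Eq w y)))))"

definition bounded_pair :: "nat \<Rightarrow> nat \<Rightarrow> nat \<Rightarrow> fm" where
  "bounded_pair x y z = (let w = fresh [x, y, z] in
    Conj (ExIn w z (bounded_upair x x w)) (Conj (ExIn w z (bounded_upair x y w))
      (AllIn w z (Disj (bounded_upair x x w) (bounded_upair x y w)))))"

definition bounded_pair_in :: "nat \<Rightarrow> nat \<Rightarrow> nat \<Rightarrow> fm" where
  "bounded_pair_in x y z = (let w = fresh [x, y, z] in ExIn w z (bounded_pair x y w))"

lemma bounded_bounded_pair [simp, intro]:
  "bounded (bounded_upair x y z)" "bounded (bounded_pair x y z)" "bounded (bounded_pair_in x y z)"
  by (auto simp: bounded_upair_def bounded_pair_def bounded_pair_in_def fresh_def Let_def)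

context basic_model
begin

lemma is_extI:
  assumes "S z" "\<And>w. P w \<Longrightarrow> w \<in> U" "\<forall>w\<in>U. R w z \<longleftrightarrow> P w"
  shows "is_ext P"
proof -
  have "R w z \<longleftrightarrow> P w" for w
    using assms(2,3) field by (cases "w \<in> U") auto
  with assms(1) show ?thesis unfolding is_ext_def by blast
qed

text \<open>In contrast to \<open>holds_is_upair\<close> there are no side conditions: the formula
  puts \<open>x\<close> and \<open>y\<close> into \<open>z\<close>, which makes them sets.\<close>

lemma holds_bounded_upair [simp]:
  "holds e (bounded_upair x y z) \<longleftrightarrow> S (e x) \<and> S (e y) \<and> e z = upair (e x) (e y)"
proof (cases "S (e x) \<and> S (e y)")
  case True
  then show ?thesis
    by (auto simp: bounded_upair_def fresh_def upair_eq dest: field)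
next
  case False
  then show ?thesis by (auto simp: bounded_upair_def fresh_def Let_def S_def)
qed

lemma pair_eq:
  assumes "S x" "S y"
  shows "z = pair x y \<longleftrightarrow> z \<in> U \<and> (\<forall>w. R w z \<longleftrightarrow> w = upair x x \<or> w = upair x y)"
  using assms by (simp add: pair_def upair_eq)

lemma holds_bounded_pair [simp]:
  "holds e (bounded_pair x y z) \<longleftrightarrow> S (e x) \<and> S (e y) \<and> e z = pair (e x) (e y)"
proof (cases "S (e x) \<and> S (e y)")
  case True
  then show ?thesis
    by (auto simp: bounded_pair_def fresh_def pair_eq dest: field)
next
  case False
  then show ?thesis by (auto simp: bounded_pair_def fresh_def)
qed

lemma holds_bounded_pair_in [simp]:
  "holds e (bounded_pair_in x y z) \<longleftrightarrow> S (e x) \<and> S (e y) \<and> R (pair (e x) (e y)) (e z)"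
  by (auto simp: bounded_pair_in_def fresh_def)

lemma above_fv: obtains c where "c > 1" "\<And>x. c \<le> x \<Longrightarrow> x \<notin> fv \<phi>"
proof -
  obtain c where c: "fv \<phi> \<subseteq> {..<c}"
    using finite_fv[of \<phi>] unfolding finite_nat_set_iff_bounded by blast
  show thesis by (rule that[of "c + 2"]) (use c in auto)
qed

text \<open>The element is variable 0, and all other variables are parameters with values from
  \<open>e\<close>. These values are sets because the axiom quantifies its parameters by
  \<open>AllSet\<close>.\<close>

lemma separation:
  assumes "bounded \<phi>" "S a" "\<And>n. S (e n)"
  shows "is_ext (\<lambda>x. R x a \<and> holds (e(0 := x)) \<phi>)"
proof -
  \<comment> \<open>The variables for the given and for the new set are taken above all free
    variables of \<open>\<phi>\<close>, so that assigning them does not affect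
    \<open>\<phi>\<close>.\<close>
  obtain c where c: "c > 1" "\<And>x. c \<le> x \<Longrightarrow> x \<notin> fv \<phi>" using above_fv[of \<phi>] by metis
  obtain ps where ps: "set ps = fv \<phi>" using finite_list[OF finite_fv] by blast
  have "Separation 0 c (c + 1) ps \<phi> \<in> basic_axioms"
    by (rule basic_axioms.intros) (use assms(1) c ps in auto)
  then have "holds e (Separation 0 c (c + 1) ps \<phi>)"
    by (rule basic) (rule S_U[OF assms(3)])
  then have "holds e (AllSet c (ExSet (c + 1) (All 0 (Iff (Mem 0 (c + 1)) (Conj (Mem 0 c) \<phi>)))))"
    unfolding Separation_def by (rule holds_foldr_AllSet) (simp_all add: assms(3))
  then obtain z where z: "S z" "\<forall>x\<in>U. R x z \<longleftrightarrow> R x a \<and> holds (e(c := a, c + 1 := z, 0 := x)) \<phi>"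
    using c(1) assms(2) by auto
  have "holds (e(c := a, c + 1 := z, 0 := x)) \<phi> \<longleftrightarrow> holds (e(0 := x)) \<phi>" for x
    by (rule sat_cong) (use c(2) in auto)
  with z have "\<forall>x\<in>U. R x z \<longleftrightarrow> R x a \<and> holds (e(0 := x)) \<phi>" by simp
  with z(1) show ?thesis unfolding is_ext_def using field by blast
qed

lemma family:
  assumes "bounded \<phi>" "S a" "S b" "\<And>n. S (e n)"
  shows "is_ext (\<lambda>w. S w \<and> (\<exists>v. R v b \<and> (\<forall>u. R u w \<longleftrightarrow> R u a \<and> holds (e(0 := u, 1 := v)) \<phi>)))"
proof -
  obtain c where c: "c > 1" "\<And>x. c \<le> x \<Longrightarrow> x \<notin> fv \<phi>" using above_fv[of \<phi>] by metis
  obtain ps where ps: "set ps = fv \<phi>" using finite_list[OF finite_fv] by blast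
  have "Family 0 1 c (c + 1) (c + 2) (c + 3) ps \<phi> \<in> basic_axioms"
    by (rule basic_axioms.intros) (use assms(1) c ps in auto)
  then have "holds e (Family 0 1 c (c + 1) (c + 2) (c + 3) ps \<phi>)"
    by (rule basic) (rule S_U[OF assms(4)])
  then have "holds e (AllSet c (AllSet (c + 1) (ExSet (c + 3) (All (c + 2) (Iff (Mem (c + 2) (c + 3))
      (Conj (is_set (c + 2)) (ExIn 1 (c + 1) (All 0 (Iff (Mem 0 (c + 2)) (Conj (Mem 0 c) \<phi>))))))))))"
    unfolding Family_def by (rule holds_foldr_AllSet) (simp_all add: assms(4))
  then have "holds (e(c := a, c + 1 := b)) (ExSet (c + 3) (All (c + 2) (Iff (Mem (c + 2) (c + 3))
      (Conj (is_set (c + 2)) (ExIn 1 (c + 1) (All 0 (Iff (Mem 0 (c + 2)) (Conj (Mem 0 c) \<phi>))))))))"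
    unfolding holds_set_quantifiers(1) using assms(2,3) by blast
  then obtain z where z: "S z" "\<forall>w\<in>U. R w z \<longleftrightarrow> S w \<and> (\<exists>v. R v b \<and> (\<forall>u\<in>U. R u w \<longleftrightarrow> R u a \<and>
      holds (e(c := a, c + 1 := b, c + 3 := z, c + 2 := w, 1 := v, 0 := u)) \<phi>))"
    using c(1) by auto
  have "holds (e(c := a, c + 1 := b, c + 3 := z, c + 2 := w, 1 := v, 0 := u)) \<phi> \<longleftrightarrow>
      holds (e(0 := u, 1 := v)) \<phi>" for u v w
    by (rule sat_cong) (use c(2) in auto)
  with z have "\<forall>w\<in>U. R w z \<longleftrightarrow> S w \<and> (\<exists>v. R v b \<and> (\<forall>u\<in>U. R u w \<longleftrightarrow> R u a \<and>
      holds (e(0 := u, 1 := v)) \<phi>))"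
    by simp
  moreover have "(\<forall>u\<in>U. R u w \<longleftrightarrow> R u a \<and> Q u) \<longleftrightarrow> (\<forall>u. R u w \<longleftrightarrow> R u a \<and> Q u)" for w Q
    using field by blast
  ultimately have "\<forall>w\<in>U. R w z \<longleftrightarrow> S w \<and> (\<exists>v. R v b \<and> (\<forall>u. R u w \<longleftrightarrow> R u a \<and>
      holds (e(0 := u, 1 := v)) \<phi>))"
    by simp
  then show ?thesis by (rule is_extI[OF z(1), rotated]) (simp add: S_U)
qed

lemma is_ext_prod:
  assumes "S a" "S b"
  shows "is_ext (\<lambda>p. \<exists>u v. R u a \<and> R v b \<and> p = pair u v)"
proof -
  have "holds (\<lambda>_. num 0) Product_axiom"
    by (rule basic[OF basic_axioms.intros(5)]) (rule num_0_in_U)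
  then have "\<forall>a. S a \<longrightarrow> (\<forall>b. S b \<longrightarrow> (\<exists>z. S z \<and>
      (\<forall>p\<in>U. R p z \<longleftrightarrow> (\<exists>u. R u a \<and> (\<exists>v. R v b \<and> p = pair u v)))))"
    by (simp add: Product_axiom_def S_I cong: conj_cong)
  then obtain z where z: "S z" "\<forall>p\<in>U. R p z \<longleftrightarrow> (\<exists>u. R u a \<and> (\<exists>v. R v b \<and> p = pair u v))"
    using assms by blast
  moreover have "pair u v \<in> U" if "R u a" "R v b" for u v
    using that S_I S_pair S_U by blast
  ultimately show ?thesis unfolding is_ext_def using field by blast
qed

lemma S_prod [simp]: "S a \<Longrightarrow> S b \<Longrightarrow> S (prod a b)"
  and R_prod [simp]: "S a \<Longrightarrow> S b \<Longrightarrow> R p (prod a b) \<longleftrightarrow> (\<exists>u v. R u a \<and> R v b \<and> p = pair u v)"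
  using coll[OF is_ext_prod] by (auto simp: prod_def)

lemma is_ext_insert:
  assumes "is_ext P" "S x"
  shows "is_ext (\<lambda>w. w = x \<or> P w)"
  using is_ext_Un[OF S_upair[OF assms(2,2)] coll(1)[OF assms(1)]] assms by (simp add: coll(2))

lemma is_ext_disj:
  assumes "is_ext P" "is_ext Q"
  shows "is_ext (\<lambda>w. P w \<or> Q w)"
  using is_ext_Un[OF assms[THEN coll(1)]] assms by (simp add: coll(2))

end

section \<open>Satisfaction inside a model\<close>

context model
begin

text \<open>This and \<open>tarski\<close> spell out \<open>is_function\<close> and
  \<open>tarski_clauses\<close> for elements of the model. They keep the quantifier nesting of the
  formulas, so that simplification alone can match the two.\<close>

definition is_fun :: "'a \<Rightarrow> 'a \<Rightarrow> 'a \<Rightarrow> bool" where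
  "is_fun s I m \<longleftrightarrow>
    (\<forall>p. R p s \<longrightarrow> (\<exists>i. R i I \<and> (\<exists>x. R x m \<and> p = pair i x))) \<and>
    (\<forall>i. R i I \<longrightarrow> (\<exists>x. R x m \<and> R (pair i x) s \<and> (\<forall>y. R y m \<longrightarrow> R (pair i y) s \<longrightarrow> y = x)))"

definition tarski :: "'a \<Rightarrow> 'a \<Rightarrow> 'a \<Rightarrow> 'a \<Rightarrow> 'a \<Rightarrow> 'a \<Rightarrow> bool" where
  "tarski m \<epsilon> I A D F \<longleftrightarrow> (\<forall>d. R d D \<longrightarrow>
      (\<exists>i. R i I \<and> (\<exists>j. R j I \<and> d = pair (num 0) (pair i j) \<and>
        (\<forall>s. R s A \<longrightarrow> (R (pair d s) F \<longleftrightarrow>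
          (\<exists>x. R x m \<and> (\<exists>y. R y m \<and> R (pair i x) s \<and> R (pair j y) s \<and> R (pair x y) \<epsilon>))))))
    \<or> (\<exists>i. R i I \<and> (\<exists>j. R j I \<and> d = pair (num 1) (pair i j) \<and>
        (\<forall>s. R s A \<longrightarrow> (R (pair d s) F \<longleftrightarrow>
          (\<exists>x. R x m \<and> (\<exists>y. R y m \<and> R (pair i x) s \<and> R (pair j y) s \<and> x = y))))))
    \<or> (\<exists>a. R a D \<and> d = pair (num 2) a \<and>
        (\<forall>s. R s A \<longrightarrow> (R (pair d s) F \<longleftrightarrow> \<not> R (pair a s) F)))
    \<or> (\<exists>a. R a D \<and> (\<exists>b. R b D \<and> d = pair (num 3) (pair a b) \<and>
        (\<forall>s. R s A \<longrightarrow> (R (pair d s) F \<longleftrightarrow> (R (pair a s) F \<longrightarrow> R (pair b s) F)))))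
    \<or> (\<exists>i. R i I \<and> (\<exists>a. R a D \<and> d = pair (num 4) (pair i a) \<and>
        (\<forall>s. R s A \<longrightarrow> (R (pair d s) F \<longleftrightarrow>
          (\<forall>r. R r A \<longrightarrow>
            (\<forall>j. R j I \<longrightarrow> j \<noteq> i \<longrightarrow> (\<exists>x. R x m \<and> R (pair j x) s \<and> R (pair j x) r)) \<longrightarrow>
            R (pair a r) F))))))"

definition inner_U :: "'a \<Rightarrow> 'a set" where
  "inner_U m = {x. R x m}"

definition inner_R :: "'a \<Rightarrow> 'a \<Rightarrow> 'a \<Rightarrow> 'a \<Rightarrow> bool" where
  "inner_R m \<epsilon> x y \<longleftrightarrow> R x m \<and> R y m \<and> R (pair x y) \<epsilon>"

end

context basic_model
begin

lemma R_in_U: "R x y \<Longrightarrow> x \<in> U"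
  using field by blast

lemma holds_is_function [simp]:
  assumes "S (e s)" "S (e I)" "S (e M)"
  shows "holds e (is_function s I M) \<longleftrightarrow> is_fun (e s) (e I) (e M)"
  using assms
  by (simp add: is_function_def is_fun_def Let_def fresh_def S_I R_in_U cong: conj_cong)

lemma bex_num [simp]: "(\<exists>t\<in>U. t = num n \<and> P t) \<longleftrightarrow> P (num n)"
  by auto

lemma holds_tarski_clauses [simp]:
  assumes "S (e M)" "S (e E)" "S (e I)" "S (e A)" "S (e D)" "S (e F)"
  shows "holds e (tarski_clauses M E I A D F) \<longleftrightarrow> tarski (e M) (e E) (e I) (e A) (e D) (e F)"
proof -
  \<comment> \<open>The fresh variable stays an opaque symbol known only through the inequalities
    \<open>ne\<close>, which spares simplification the arithmetic of the sum behind it.\<close>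
  obtain d where d: "d = fresh [M, E, I, A, D, F]" by blast
  then have "M < d" "E < d" "I < d" "A < d" "D < d" "F < d" by (simp_all add: fresh_def)
  then have ne: "M \<noteq> d + k" "E \<noteq> d + k" "I \<noteq> d + k" "A \<noteq> d + k" "D \<noteq> d + k" "F \<noteq> d + k"
    "M \<noteq> d" "E \<noteq> d" "I \<noteq> d" "A \<noteq> d" "D \<noteq> d" "F \<noteq> d" for k
    by auto
  show ?thesis
    unfolding tarski_clauses_def d[symmetric] Let_def tarski_def
    using assms
    by (simp add: ne ne[symmetric] S_I R_in_U del: One_nat_def add_Suc_right add_2_eq_Suc' cong: conj_cong)
qed

text \<open>The part of \<open>satisfies\<close> that does not mention a particular code;
  \<open>fails_at_copy\<close> asks for the same data.\<close>

definition good :: "'a \<Rightarrow> 'a \<Rightarrow> 'a \<Rightarrow> 'a \<Rightarrow> 'a \<Rightarrow> 'a \<Rightarrow> bool" where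
  "good m \<epsilon> I A D F \<longleftrightarrow> S I \<and> S A \<and> S D \<and> S F \<and>
    (\<forall>s. R s A \<longleftrightarrow> S s \<and> is_fun s I m) \<and> tarski m \<epsilon> I A D F"

lemma all_assignments:
  "(\<forall>s\<in>U. R s A \<longleftrightarrow> S s \<and> P s) \<longleftrightarrow> (\<forall>s. R s A \<longleftrightarrow> S s \<and> P s)"
  using field S_U by blast

lemma holds_satisfies [simp]:
  assumes "S (e M)" "S (e E)" "S (e c)"
  shows "holds e (satisfies M E c) \<longleftrightarrow>
    (\<exists>I A D F. good (e M) (e E) I A D F \<and> R (e c) D \<and> (\<forall>s. R s A \<longrightarrow> R (pair (e c) s) F))"
proof -
  have "holds e (satisfies M E c) \<longleftrightarrow>
    (\<exists>I. S I \<and> (\<exists>A. S A \<and> (\<exists>D. S D \<and> (\<exists>F. S F \<and> (\<forall>s\<in>U. R s A \<longleftrightarrow> S s \<and> is_fun s I (e M)) \<and>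
      tarski (e M) (e E) I A D F \<and> R (e c) D \<and> (\<forall>s. R s A \<longrightarrow> R (pair (e c) s) F)))))"
    using assms by (simp add: satisfies_def Let_def fresh_def S_I cong: conj_cong)
  also have "\<dots> \<longleftrightarrow> (\<exists>I A D F. good (e M) (e E) I A D F \<and> R (e c) D \<and> (\<forall>s. R s A \<longrightarrow> R (pair (e c) s) F))"
    unfolding all_assignments good_def by blast
  finally show ?thesis .
qed

lemma holds_is_structure [simp]:
  assumes "S (e M)" "S (e E)"
  shows "holds e (is_structure M E) \<longleftrightarrow> (\<exists>x. R x (e M)) \<and>
    (\<forall>p. R p (e E) \<longrightarrow> (\<exists>x. R x (e M) \<and> (\<exists>y. R y (e M) \<and> p = pair x y)))"
proof -
  have *: "(\<exists>x\<in>U. R x y) \<longleftrightarrow> (\<exists>x. R x y)" for y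
    using R_in_U by blast
  show ?thesis
    using assms by (simp add: is_structure_def Let_def fresh_def S_I R_in_U * cong: conj_cong)
qed

end

section \<open>Assignments in the model and actual valuations\<close>

locale assignments = basic_model +
  fixes m \<epsilon> I A :: 'a
  assumes S_m: "S m" and S_eps: "S \<epsilon>" and S_I': "S I" and S_A: "S A"
    and m_nonempty: "\<exists>x. R x m"
    and R_A: "R s A \<longleftrightarrow> S s \<and> is_fun s I m"
begin

text \<open>\<open>I\<close> is whatever index set the model offers; it may lack numerals and
  contain other objects. A numeral outside \<open>I\<close> gets a default that does not depend on
  \<open>s\<close>, so that two assignments agreeing on \<open>I\<close> except at \<open>k\<close>
  have valuations that differ at most at \<open>k\<close>.\<close>

definition val :: "'a \<Rightarrow> nat \<Rightarrow> 'a" where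
  "val s k = (if R (num k) I then THE x. R x m \<and> R (pair (num k) x) s else (SOME x. R x m))"

abbreviation N :: "(nat \<Rightarrow> 'a) \<Rightarrow> fm \<Rightarrow> bool" where
  "N \<equiv> sat (inner_U m) (inner_R m \<epsilon>)"

lemma R_m_if_pair: "R s A \<Longrightarrow> R (pair i x) s \<Longrightarrow> S i \<Longrightarrow> S x \<Longrightarrow> R x m"
  unfolding R_A is_fun_def by (metis S_I pair_inject)

lemma val_cases:
  assumes "R s A" "R (num k) I"
  shows "R (val s k) m" "S x \<Longrightarrow> R (pair (num k) x) s \<longleftrightarrow> x = val s k"
proof -
  obtain x0 where x0: "R x0 m" "R (pair (num k) x0) s" "\<And>y. R y m \<Longrightarrow> R (pair (num k) y) s \<Longrightarrow> y = x0"
    using assms unfolding R_A is_fun_def by blast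
  have "val s k = x0"
    unfolding val_def if_P[OF assms(2)] using x0 by (intro the_equality) blast+
  then show "R (val s k) m" "S x \<Longrightarrow> R (pair (num k) x) s \<longleftrightarrow> x = val s k"
    using x0 R_m_if_pair[OF assms(1) _ S_num] by blast+
qed

lemma val_in_m: "R s A \<Longrightarrow> R (val s k) m"
  using val_cases(1) m_nonempty by (cases "R (num k) I") (auto simp: val_def intro: someI_ex)

lemma val_eqI:
  assumes "R s A" "R r A" "R (num k) I"
    and "\<And>l. R (num l) I \<Longrightarrow> l \<noteq> k \<Longrightarrow> val r l = val s l"
  shows "val r = (val s)(k := val r k)"
proof
  fix l show "val r l = ((val s)(k := val r k)) l"
  proof (cases "l = k \<or> R (num l) I")
    case True
    then show ?thesis using assms(4) by auto
  next
    case False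
    then show ?thesis by (simp add: val_def)
  qed
qed

text \<open>The condition in the quantifier clause of \<open>tarski\<close>. It concerns all indices
  in \<open>I\<close>, while \<open>val\<close> sees the numerals only; \<open>variant\<close> must
  therefore provide it along with the valuation.\<close>

definition agree_off :: "nat \<Rightarrow> 'a \<Rightarrow> 'a \<Rightarrow> bool" where
  "agree_off k s r \<longleftrightarrow>
    (\<forall>j. R j I \<longrightarrow> j \<noteq> num k \<longrightarrow> (\<exists>x. R x m \<and> R (pair j x) s \<and> R (pair j x) r))"

lemma val_agree_off:
  assumes "R s A" "R r A" "R (num k) I" "agree_off k s r"
  shows "val r = (val s)(k := val r k)"
proof (rule val_eqI[OF assms(1-3)])
  fix l assume "R (num l) I" "l \<noteq> k"
  then obtain x where "R x m" "R (pair (num l) x) s" "R (pair (num l) x) r"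
    using assms(4) by (auto simp: agree_off_def)
  then show "val r l = val s l"
    using val_cases(2)[OF assms(1) \<open>R (num l) I\<close>] val_cases(2)[OF assms(2) \<open>R (num l) I\<close>] S_I by metis
qed

lemma variant:
  assumes s: "R s A" and k: "R (num k) I" and a: "R a m"
  obtains r where "R r A" "val r = (val s)(k := a)" "agree_off k s r"
proof -
  \<comment> \<open>Variables 1 to 4 hold \<open>num k\<close>, \<open>a\<close>, \<open>s\<close>,
    \<open>m\<close>. The formula drops the pairs of \<open>s\<close> with first component
    \<open>num k\<close> and admits the pair of \<open>num k\<close> and \<open>a\<close>
    instead.\<close>
  let ?e = "(\<lambda>_. num 0)(1 := num k, 2 := a, 3 := s, 4 := m)"
  let ?\<phi> = "Disj (bounded_pair 1 2 0) (Conj (Mem 0 3) (Neg (ExIn 5 4 (bounded_pair 1 5 0))))"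
  have S: "S a" "S s" using a s S_I by auto
  have "is_ext (\<lambda>p. R p (prod I m) \<and> holds (?e(0 := p)) ?\<phi>)"
    by (rule separation) (auto simp: S S_I' S_m)
  then have "is_ext (\<lambda>p. R p (prod I m) \<and> (p = pair (num k) a \<or> R p s \<and> \<not> (\<exists>x. R x m \<and> p = pair (num k) x)))"
    by (rule is_ext_cong) (simp add: S S_I cong: conj_cong)
  then obtain r where r: "S r" "\<And>p. R p r \<longleftrightarrow> R p (prod I m) \<and>
      (p = pair (num k) a \<or> R p s \<and> \<not> (\<exists>x. R x m \<and> p = pair (num k) x))"
    unfolding is_ext_def by blast
  have r_k: "R (pair (num k) x) r \<longleftrightarrow> x = a" if "R x m" for x
    using that k a S by (auto simp: r S_I' S_m S_I)
  have r_j: "R (pair j x) r \<longleftrightarrow> R (pair j x) s" if "R j I" "j \<noteq> num k" "R x m" for j x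
    using that k a S by (auto simp: r S_I' S_m S_I)
  have fs: "is_fun s I m" using s R_A by blast
  have "is_fun r I m"
    unfolding is_fun_def
  proof (intro conjI allI impI)
    fix p assume "R p r"
    then show "\<exists>i. R i I \<and> (\<exists>x. R x m \<and> p = pair i x)" by (auto simp: r S_I' S_m)
  next
    fix j assume j: "R j I"
    show "\<exists>x. R x m \<and> R (pair j x) r \<and> (\<forall>y. R y m \<longrightarrow> R (pair j y) r \<longrightarrow> y = x)"
    proof (cases "j = num k")
      case True
      then show ?thesis using a r_k by blast
    next
      case False
      then show ?thesis using fs j r_j unfolding is_fun_def by metis
    qed
  qed
  with r(1) have rA: "R r A" by (simp add: R_A)
  have ag: "agree_off k s r"
    unfolding agree_off_def using fs r_j unfolding is_fun_def by metis
  have "val r k = a"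
    using val_cases(2)[OF rA k S(1)] r_k[OF a] by simp
  with val_agree_off[OF s rA k ag] have "val r = (val s)(k := a)" by simp
  with rA ag show thesis using that by blast
qed

text \<open>Quantifying over elements amounts to quantifying over assignments: each assignment that
  agrees off \<open>k\<close> updates the valuation at \<open>k\<close>, and by
  \<open>variant\<close> each update by an element of \<open>m\<close> arises in this way.\<close>

lemma N_All:
  assumes "R s A" "R (num k) I"
  shows "N (val s) (All k \<phi>) \<longleftrightarrow> (\<forall>r. R r A \<longrightarrow> agree_off k s r \<longrightarrow> N (val r) \<phi>)"
proof
  assume "N (val s) (All k \<phi>)"
  then have "N ((val s)(k := a)) \<phi>" if "R a m" for a
    using that by (simp add: inner_U_def)
  then show "\<forall>r. R r A \<longrightarrow> agree_off k s r \<longrightarrow> N (val r) \<phi>"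
    using val_agree_off[OF assms(1) _ assms(2)] val_in_m by metis
next
  assume *: "\<forall>r. R r A \<longrightarrow> agree_off k s r \<longrightarrow> N (val r) \<phi>"
  have "N ((val s)(k := a)) \<phi>" if "R a m" for a
    using variant[OF assms that] * by metis
  then show "N (val s) (All k \<phi>)" by (simp add: inner_U_def)
qed

lemma N_Mem:
  assumes "R s A" "R (num i) I" "R (num j) I"
  shows "N (val s) (Mem i j) \<longleftrightarrow>
    (\<exists>x. R x m \<and> (\<exists>y. R y m \<and> R (pair (num i) x) s \<and> R (pair (num j) y) s \<and> R (pair x y) \<epsilon>))"
  using val_cases[OF assms(1,2)] val_cases[OF assms(1,3)] S_I
  by (simp add: inner_R_def) metis

lemma N_Eq:
  assumes "R s A" "R (num i) I" "R (num j) I"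
  shows "N (val s) (Eq i j) \<longleftrightarrow>
    (\<exists>x. R x m \<and> (\<exists>y. R y m \<and> R (pair (num i) x) s \<and> R (pair (num j) y) s \<and> x = y))"
  using val_cases[OF assms(1,2)] val_cases[OF assms(1,3)] S_I
  by simp metis

text \<open>The code of an actual formula decides which of Tarski's clauses applies, and the clause
  puts the codes of the immediate subformulas into \<open>D\<close>. Any \<open>F\<close> that obeys
  the clauses is thus determined on actual formulas, whatever else \<open>D\<close>
  contains.\<close>

lemma tarski_correct:
  assumes "tarski m \<epsilon> I A D F" "R (code \<phi>) D" "R s A"
  shows "R (pair (code \<phi>) s) F \<longleftrightarrow> N (val s) \<phi>"
  using assms(2,3)
proof (induction \<phi> arbitrary: s)
  case (Mem x y)
  have "R (num x) I \<and> R (num y) I \<and> (R (pair (code (Mem x y)) s) F \<longleftrightarrow>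
    (\<exists>u. R u m \<and> (\<exists>v. R v m \<and> R (pair (num x) u) s \<and> R (pair (num y) v) s \<and> R (pair u v) \<epsilon>)))"
    using assms(1)[unfolded tarski_def, rule_format, OF Mem(1)] Mem(2) by (auto simp: S_I)
  then show ?case using N_Mem[OF Mem(2)] by blast
next
  case (Eq x y)
  have "R (num x) I \<and> R (num y) I \<and> (R (pair (code (Eq x y)) s) F \<longleftrightarrow>
    (\<exists>u. R u m \<and> (\<exists>v. R v m \<and> R (pair (num x) u) s \<and> R (pair (num y) v) s \<and> u = v)))"
    using assms(1)[unfolded tarski_def, rule_format, OF Eq(1)] Eq(2) by (auto simp: S_I)
  then show ?case using N_Eq[OF Eq(2)] by blast
next
  case (Neg \<phi>)
  have "R (code \<phi>) D \<and> (R (pair (code (Neg \<phi>)) s) F \<longleftrightarrow> \<not> R (pair (code \<phi>) s) F)"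
    using assms(1)[unfolded tarski_def, rule_format, OF Neg.prems(1)] Neg.prems(2) by (auto simp: S_I)
  then show ?case using Neg.IH[OF _ Neg.prems(2)] by simp
next
  case (Imp \<phi> \<psi>)
  have "R (code \<phi>) D \<and> R (code \<psi>) D \<and> (R (pair (code (Imp \<phi> \<psi>)) s) F \<longleftrightarrow>
      (R (pair (code \<phi>) s) F \<longrightarrow> R (pair (code \<psi>) s) F))"
    using assms(1)[unfolded tarski_def, rule_format, OF Imp.prems(1)] Imp.prems(2) by (auto simp: S_I)
  then show ?case using Imp.IH(1)[OF _ Imp.prems(2)] Imp.IH(2)[OF _ Imp.prems(2)] by simp
next
  case (All k \<phi>)
  have "R (num k) I \<and> R (code \<phi>) D \<and> (R (pair (code (All k \<phi>)) s) F \<longleftrightarrow>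
      (\<forall>r. R r A \<longrightarrow> agree_off k s r \<longrightarrow> R (pair (code \<phi>) r) F))"
    unfolding agree_off_def
    using assms(1)[unfolded tarski_def, rule_format, OF All.prems(1)] All.prems(2) by (auto simp: S_I)
  then show ?case using N_All[OF All.prems(2)] All.IH by blast
qed

end

section \<open>Sets of functions on a numeral\<close>

context basic_model
begin

lemma is_fun_Suc:
  assumes "S m" "S w"
  shows "is_fun w (num (Suc n)) m \<longleftrightarrow>
    (\<exists>s x. S s \<and> is_fun s (num n) m \<and> R x m \<and> (\<forall>u. R u w \<longleftrightarrow> R u s \<or> u = pair (num n) x))"
proof
  assume w: "is_fun w (num (Suc n)) m"
  \<comment> \<open>The restriction of \<open>w\<close> to \<open>num n\<close> is the intersection
    of \<open>w\<close> with the product of \<open>num n\<close> and \<open>m\<close>.\<close>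
  have "is_ext (\<lambda>p. R p w \<and> holds ((\<lambda>_. prod (num n) m)(0 := p)) (Mem 0 1))"
    by (rule separation) (auto simp: assms)
  then obtain s where s: "S s" "\<And>p. R p s \<longleftrightarrow> R p w \<and> R p (prod (num n) m)"
    by (auto simp: is_ext_def)
  obtain x where x: "R x m" "R (pair (num n) x) w"
    "\<And>y. R y m \<Longrightarrow> R (pair (num n) y) w \<Longrightarrow> y = x"
    using w[unfolded is_fun_def, THEN conjunct2, rule_format, of "num n"] by (auto simp: num_Suc)
  have "R u w \<longleftrightarrow> R u s \<or> u = pair (num n) x" for u
  proof
    assume "R u w"
    then obtain i y where iy: "R i (num (Suc n))" "R y m" "u = pair i y"
      using w unfolding is_fun_def by blast
    then have "R i (num n) \<or> i = num n" by (auto simp: num_Suc)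
    then show "R u s \<or> u = pair (num n) x"
    proof
      assume "R i (num n)"
      then have "R u (prod (num n) m)" using iy assms by (subst R_prod) auto
      with \<open>R u w\<close> show ?thesis by (simp add: s(2))
    next
      assume "i = num n"
      with x(3)[of y] iy \<open>R u w\<close> show ?thesis by simp
    qed
  next
    assume "R u s \<or> u = pair (num n) x"
    then show "R u w" using s(2) x(2) by blast
  qed
  moreover have "is_fun s (num n) m"
    unfolding is_fun_def
  proof (intro conjI allI impI)
    fix p assume "R p s"
    then have "R p (prod (num n) m)" by (simp add: s(2))
    then show "\<exists>i. R i (num n) \<and> (\<exists>x. R x m \<and> p = pair i x)"
      using assms by auto
  next
    fix i assume i: "R i (num n)"
    then have "R i (num (Suc n))" by (simp add: num_Suc)
    then obtain x where x: "R x m" "R (pair i x) w" "\<And>y. R y m \<Longrightarrow> R (pair i y) w \<Longrightarrow> y = x"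
      using w unfolding is_fun_def by blast
    have "R (pair i x) (prod (num n) m)" using i x(1) assms by (subst R_prod) auto
    with x(2) have "R (pair i x) s" by (simp only: s(2))
    moreover have "y = x" if "R y m" "R (pair i y) s" for y
      using x(3) that by (simp only: s(2))
    ultimately show "\<exists>x. R x m \<and> R (pair i x) s \<and> (\<forall>y. R y m \<longrightarrow> R (pair i y) s \<longrightarrow> y = x)"
      using x(1) by blast
  qed
  ultimately show "\<exists>s x. S s \<and> is_fun s (num n) m \<and> R x m \<and>
      (\<forall>u. R u w \<longleftrightarrow> R u s \<or> u = pair (num n) x)"
    using s(1) x(1) by (intro exI[of _ s] exI[of _ x]) simp
next
  assume "\<exists>s x. S s \<and> is_fun s (num n) m \<and> R x m \<and>
      (\<forall>u. R u w \<longleftrightarrow> R u s \<or> u = pair (num n) x)"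
  then obtain s x where s: "S s" "is_fun s (num n) m" and x: "R x m"
    and w: "\<And>u. R u w \<longleftrightarrow> R u s \<or> u = pair (num n) x" by blast
  \<comment> \<open>Foundation is not at hand; that a numeral is not an element of itself comes from
    the distinctness of numerals.\<close>
  have nn: "\<not> R (num n) (num n)" by (auto simp: R_num)
  have s_n: "\<not> R (pair (num n) y) s" if "R y m" for y
  proof
    assume "R (pair (num n) y) s"
    then obtain i z where "R i (num n)" "R z m" "pair (num n) y = pair i z"
      using s unfolding is_fun_def by blast
    with nn that show False by (auto simp: S_I)
  qed
  show "is_fun w (num (Suc n)) m"
    unfolding is_fun_def
  proof (intro conjI allI impI)
    fix p assume "R p w"
    then consider "R p s" | "p = pair (num n) x" using w by blast
    then obtain i z where "R i (num n) \<or> i = num n" "R z m" "p = pair i z"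
      using s(2) x unfolding is_fun_def by (cases; blast)
    then show "\<exists>i. R i (num (Suc n)) \<and> (\<exists>x. R x m \<and> p = pair i x)"
      by (auto simp: num_Suc)
  next
    fix i assume i: "R i (num (Suc n))"
    show "\<exists>x. R x m \<and> R (pair i x) w \<and> (\<forall>y. R y m \<longrightarrow> R (pair i y) w \<longrightarrow> y = x)"
    proof (cases "i = num n")
      case True
      then show ?thesis using x s_n w by (intro exI[of _ x]) (auto simp: S_I)
    next
      case False
      with i have i': "R i (num n)" by (auto simp: num_Suc)
      then obtain z where z: "R z m" "R (pair i z) s" "\<And>y. R y m \<Longrightarrow> R (pair i y) s \<Longrightarrow> y = z"
        using s(2) unfolding is_fun_def by blast
      have "R (pair i y) w \<longleftrightarrow> R (pair i y) s" if "R y m" for y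
        using that False i' x by (auto simp: w S_I)
      with z show ?thesis by blast
    qed
  qed
qed

text \<open>The set of functions is built by recursion on \<open>n\<close>, in place of cutting it
  out of a power set: the family axiom replaces each pair of a function \<open>s\<close> and a new
  value \<open>x\<close> by \<open>s\<close> with one more pair.\<close>

lemma is_ext_is_fun:
  assumes "S m"
  shows "is_ext (\<lambda>s. S s \<and> is_fun s (num n) m)"
proof (induction n)
  case 0
  have "S s \<and> is_fun s (num 0) m \<longleftrightarrow> s = num 0 \<or> s = num 0" for s
    using S_ext[of s "num 0"] by (auto simp: is_fun_def)
  then show ?case using is_ext_upair[OF S_num S_num, of 0 0] by simp
next
  case (Suc n)
  obtain A where A: "S A" "\<And>s. R s A \<longleftrightarrow> S s \<and> is_fun s (num n) m"
    using Suc unfolding is_ext_def by blast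
  obtain V where V: "S V" "\<And>u. R u V \<longleftrightarrow> (\<exists>s. R s A \<and> R u s)"
    using is_ext_Union[OF A(1)] unfolding is_ext_def by blast
  \<comment> \<open>The ambient set of the family contains all elements of the functions in
    \<open>A\<close> and all possible new pairs. In the formula, variables 5 and 6 unpack the index
    \<open>v\<close> into \<open>s\<close> and \<open>x\<close>.\<close>
  let ?a = "un V (prod (upair (num n) (num n)) m)"
  let ?e = "(\<lambda>_. num 0)(2 := A, 3 := m, 4 := num n)"
  let ?\<phi> = "ExIn 5 2 (ExIn 6 3 (Conj (bounded_pair 5 6 1) (Disj (Mem 0 5) (bounded_pair 4 6 0))))"
  have fam: "is_ext (\<lambda>w. S w \<and> (\<exists>v. R v (prod A m) \<and>
      (\<forall>u. R u w \<longleftrightarrow> R u ?a \<and> holds (?e(0 := u, 1 := v)) ?\<phi>)))"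
    by (rule family) (auto simp: A assms V)
  have key: "(\<exists>v. R v (prod A m) \<and> (\<forall>u. R u w \<longleftrightarrow> R u ?a \<and> holds (?e(0 := u, 1 := v)) ?\<phi>)) \<longleftrightarrow>
      (\<exists>s x. S s \<and> is_fun s (num n) m \<and> R x m \<and> (\<forall>u. R u w \<longleftrightarrow> R u s \<or> u = pair (num n) x))" for w
  proof -
    have "R u ?a \<and> holds (?e(0 := u, 1 := pair s x)) ?\<phi> \<longleftrightarrow> R u s \<or> u = pair (num n) x"
      if "R s A" "R x m" for u s x
    proof -
      have "holds (?e(0 := u, 1 := pair s x)) ?\<phi> \<longleftrightarrow>
          (\<exists>s'. R s' A \<and> (\<exists>x'. R x' m \<and> pair s x = pair s' x' \<and> (R u s' \<or> u = pair (num n) x')))"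
        by (simp add: S_I cong: conj_cong)
      also have "\<dots> \<longleftrightarrow> R u s \<or> u = pair (num n) x"
        using that by (auto simp: S_I)
      finally show ?thesis using that V assms by auto
    qed
    then have "(\<forall>u. R u w \<longleftrightarrow> R u ?a \<and> holds (?e(0 := u, 1 := pair s x)) ?\<phi>) \<longleftrightarrow>
        (\<forall>u. R u w \<longleftrightarrow> R u s \<or> u = pair (num n) x)" if "R s A" "R x m" for s x
      using that by (simp only:)
    moreover have "(\<exists>v. R v (prod A m) \<and> P v) \<longleftrightarrow> (\<exists>s x. R s A \<and> R x m \<and> P (pair s x))" for P
      using A(1) assms by auto
    ultimately show ?thesis unfolding conj_assoc[symmetric] A(2)[symmetric]
      by (simp only: conj_assoc cong: conj_cong)
  qed
  show ?case
    by (rule is_ext_cong[OF fam]) (simp only: key is_fun_Suc[OF assms] cong: conj_cong)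
qed

end

section \<open>Existence of satisfaction relations for actual formulas\<close>

primrec subformulas :: "fm \<Rightarrow> fm set" where
  "subformulas (Mem x y) = {Mem x y}"
| "subformulas (Eq x y) = {Eq x y}"
| "subformulas (Neg \<phi>) = insert (Neg \<phi>) (subformulas \<phi>)"
| "subformulas (Imp \<phi> \<psi>) = insert (Imp \<phi> \<psi>) (subformulas \<phi> \<union> subformulas \<psi>)"
| "subformulas (All x \<phi>) = insert (All x \<phi>) (subformulas \<phi>)"

lemma finite_subformulas [simp]: "finite (subformulas \<phi>)"
  by (induction \<phi>) auto

lemma subformulas_refl [simp]: "\<phi> \<in> subformulas \<phi>"
  by (cases \<phi>) auto

lemma subformulas_trans: "\<psi> \<in> subformulas \<phi> \<Longrightarrow> subformulas \<psi> \<subseteq> subformulas \<phi>"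
  by (induction \<phi>) auto

lemma vars_subformulas: "\<psi> \<in> subformulas \<phi> \<Longrightarrow> fv \<psi> \<union> bv \<psi> \<subseteq> fv \<phi> \<union> bv \<phi>"
  by (induction \<phi>) auto

context assignments
begin

text \<open>Satisfaction as such is not a bounded formula. For one given formula it is reached by
  one separation per connective, each with the sets obtained for the immediate subformulas as
  parameters.\<close>

lemma definable:
  assumes "\<forall>k\<in>fv \<phi> \<union> bv \<phi>. R (num k) I"
  shows "is_ext (\<lambda>s. R s A \<and> N (val s) \<phi>)"
  using assms
proof (induction \<phi>)
  case (Mem i j)
  let ?e = "(\<lambda>_. num 0)(1 := num i, 2 := num j, 3 := m, 4 := \<epsilon>)"
  let ?\<phi> = "ExIn 5 3 (ExIn 6 3 (Conj (bounded_pair_in 1 5 0)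
    (Conj (bounded_pair_in 2 6 0) (bounded_pair_in 5 6 4))))"
  have "is_ext (\<lambda>s. R s A \<and> holds (?e(0 := s)) ?\<phi>)"
    by (rule separation) (auto simp: S_A S_m S_eps)
  then show ?case
    by (rule is_ext_cong) (use Mem N_Mem[of _ i j] in \<open>simp add: S_I cong: conj_cong\<close>)
next
  case (Eq i j)
  let ?e = "(\<lambda>_. num 0)(1 := num i, 2 := num j, 3 := m)"
  let ?\<phi> = "ExIn 5 3 (ExIn 6 3 (Conj (bounded_pair_in 1 5 0)
    (Conj (bounded_pair_in 2 6 0) (Eq 5 6))))"
  have "is_ext (\<lambda>s. R s A \<and> holds (?e(0 := s)) ?\<phi>)"
    by (rule separation) (auto simp: S_A S_m)
  then show ?case
    by (rule is_ext_cong) (use Eq N_Eq[of _ i j] in \<open>simp add: S_I cong: conj_cong\<close>)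
next
  case (Neg \<phi>)
  then obtain X where X: "S X" "\<And>s. R s X \<longleftrightarrow> R s A \<and> N (val s) \<phi>"
    unfolding is_ext_def by auto
  have "is_ext (\<lambda>s. R s A \<and> holds ((\<lambda>_. X)(0 := s)) (Neg (Mem 0 1)))"
    by (rule separation) (auto simp: S_A X)
  then show ?case by (rule is_ext_cong) (auto simp: X)
next
  case (Imp \<phi> \<psi>)
  then obtain X where X: "S X" "\<And>s. R s X \<longleftrightarrow> R s A \<and> N (val s) \<phi>"
    unfolding is_ext_def by auto
  from Imp obtain Y where Y: "S Y" "\<And>s. R s Y \<longleftrightarrow> R s A \<and> N (val s) \<psi>"
    unfolding is_ext_def by auto
  have "is_ext (\<lambda>s. R s A \<and> holds ((\<lambda>_. X)(2 := Y, 0 := s)) (Imp (Mem 0 1) (Mem 0 2)))"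
    by (rule separation) (auto simp: S_A X(1) Y(1))
  then show ?case by (rule is_ext_cong) (auto simp: X Y)
next
  case (All k \<phi>)
  then obtain X where X: "S X" "\<And>s. R s X \<longleftrightarrow> R s A \<and> N (val s) \<phi>"
    unfolding is_ext_def by auto
  \<comment> \<open>Variables 1 to 5 hold \<open>I\<close>, \<open>num k\<close>, \<open>m\<close>,
    \<open>A\<close>, \<open>X\<close>. The quantifier clause is bounded since it ranges over
    assignments in the set \<open>A\<close>, and \<open>X\<close> replaces satisfaction of the
    body.\<close>
  let ?e = "(\<lambda>_. num 0)(1 := I, 2 := num k, 3 := m, 4 := A, 5 := X)"
  let ?\<phi> = "AllIn 6 4 (Imp (AllIn 7 1 (Imp (Neg (Eq 7 2)) (ExIn 8 3
    (Conj (bounded_pair_in 7 8 0) (bounded_pair_in 7 8 6))))) (Mem 6 5))"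
  have "is_ext (\<lambda>s. R s A \<and> holds (?e(0 := s)) ?\<phi>)"
    by (rule separation) (auto simp: S_A S_m S_I' X(1))
  moreover have "holds (?e(0 := s)) ?\<phi> \<longleftrightarrow> N (val s) (All k \<phi>)" if "R s A" for s
  proof -
    have "holds (?e(0 := s)) ?\<phi> \<longleftrightarrow> (\<forall>r. R r A \<longrightarrow> agree_off k s r \<longrightarrow> R r X)"
      unfolding agree_off_def by (simp add: S_I cong: conj_cong)
    then show ?thesis using N_All[OF that, of k \<phi>] All.prems by (simp only: X) auto
  qed
  ultimately show ?case by (elim is_ext_cong) blast
qed

lemma is_ext_codes: "finite L \<Longrightarrow> is_ext (\<lambda>d. d \<in> code ` L)"
proof (induction rule: finite_induct)
  case empty
  then show ?case using is_ext_empty by simp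
next
  case (insert \<phi> L)
  then show ?case using is_ext_insert[OF insert.IH S_code] by simp
qed

text \<open>A finite union of products: the singleton of each code times the set of assignments that
  \<open>definable\<close> provides.\<close>

lemma is_ext_satisfaction:
  assumes "finite L" "\<And>\<phi>. \<phi> \<in> L \<Longrightarrow> \<forall>k\<in>fv \<phi> \<union> bv \<phi>. R (num k) I"
  shows "is_ext (\<lambda>p. \<exists>\<phi>\<in>L. \<exists>s. R s A \<and> N (val s) \<phi> \<and> p = pair (code \<phi>) s)"
  using assms
proof (induction rule: finite_induct)
  case empty
  then show ?case using is_ext_empty by simp
next
  case (insert \<phi> L)
  obtain X where X: "S X" "\<And>s. R s X \<longleftrightarrow> R s A \<and> N (val s) \<phi>"
    using definable[of \<phi>] insert.prems unfolding is_ext_def by auto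
  have "is_ext (\<lambda>p. \<exists>s. R s A \<and> N (val s) \<phi> \<and> p = pair (code \<phi>) s)"
    using is_ext_prod[OF S_upair[OF S_code S_code] X(1), of \<phi> \<phi>]
    by (elim is_ext_cong) (auto simp: X)
  then have "is_ext (\<lambda>p. (\<exists>s. R s A \<and> N (val s) \<phi> \<and> p = pair (code \<phi>) s) \<or>
      (\<exists>\<phi>\<in>L. \<exists>s. R s A \<and> N (val s) \<phi> \<and> p = pair (code \<phi>) s))"
    by (rule is_ext_disj) (use insert in auto)
  then show ?case by simp
qed

text \<open>Taking for \<open>D\<close> just the codes of subformulas keeps it finite, so it exists
  without an axiom of infinity, and \<open>F\<close> needs only finitely many instances of
  \<open>definable\<close>.\<close>

lemma good_exists:
  assumes "\<forall>k\<in>fv \<phi> \<union> bv \<phi>. R (num k) I"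
  obtains D F where "good m \<epsilon> I A D F" "R (code \<phi>) D"
proof -
  let ?L = "subformulas \<phi>"
  have vars: "\<forall>k\<in>fv \<psi> \<union> bv \<psi>. R (num k) I" if "\<psi> \<in> ?L" for \<psi>
    using that vars_subformulas assms by blast
  obtain D where D: "S D" "\<And>d. R d D \<longleftrightarrow> d \<in> code ` ?L"
    using is_ext_codes[of ?L] unfolding is_ext_def by auto
  obtain F where F: "S F"
      "\<And>p. R p F \<longleftrightarrow> (\<exists>\<phi>\<in>?L. \<exists>s. R s A \<and> N (val s) \<phi> \<and> p = pair (code \<phi>) s)"
    using is_ext_satisfaction[of ?L] vars unfolding is_ext_def by auto
  have R_F: "R (pair (code \<psi>) s) F \<longleftrightarrow> N (val s) \<psi>" if "\<psi> \<in> ?L" "R s A" for \<psi> s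
    unfolding F(2) using that by (auto simp: S_I)
  have sub: "subformulas \<psi> \<subseteq> ?L" if "\<psi> \<in> ?L" for \<psi>
    using that by (rule subformulas_trans)
  have "tarski m \<epsilon> I A D F"
    unfolding tarski_def
  proof (intro allI impI)
    fix d assume "R d D"
    then obtain \<psi> where \<psi>: "\<psi> \<in> ?L" "d = code \<psi>" using D by blast
    have RF: "R (pair d s) F \<longleftrightarrow> N (val s) \<psi>" if "R s A" for s
      using R_F \<psi> that by blast
    show "(\<exists>i. R i I \<and> (\<exists>j. R j I \<and> d = pair (num 0) (pair i j) \<and>
        (\<forall>s. R s A \<longrightarrow> (R (pair d s) F \<longleftrightarrow>
          (\<exists>x. R x m \<and> (\<exists>y. R y m \<and> R (pair i x) s \<and> R (pair j y) s \<and> R (pair x y) \<epsilon>))))))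
    \<or> (\<exists>i. R i I \<and> (\<exists>j. R j I \<and> d = pair (num 1) (pair i j) \<and>
        (\<forall>s. R s A \<longrightarrow> (R (pair d s) F \<longleftrightarrow>
          (\<exists>x. R x m \<and> (\<exists>y. R y m \<and> R (pair i x) s \<and> R (pair j y) s \<and> x = y))))))
    \<or> (\<exists>a. R a D \<and> d = pair (num 2) a \<and>
        (\<forall>s. R s A \<longrightarrow> (R (pair d s) F \<longleftrightarrow> \<not> R (pair a s) F)))
    \<or> (\<exists>a. R a D \<and> (\<exists>b. R b D \<and> d = pair (num 3) (pair a b) \<and>
        (\<forall>s. R s A \<longrightarrow> (R (pair d s) F \<longleftrightarrow> (R (pair a s) F \<longrightarrow> R (pair b s) F)))))
    \<or> (\<exists>i. R i I \<and> (\<exists>a. R a D \<and> d = pair (num 4) (pair i a) \<and>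
        (\<forall>s. R s A \<longrightarrow> (R (pair d s) F \<longleftrightarrow>
          (\<forall>r. R r A \<longrightarrow>
            (\<forall>j. R j I \<longrightarrow> j \<noteq> i \<longrightarrow> (\<exists>x. R x m \<and> R (pair j x) s \<and> R (pair j x) r)) \<longrightarrow>
            R (pair a r) F)))))" (is "?A \<or> ?B \<or> ?C \<or> ?D \<or> ?E")
    proof (cases \<psi>)
      case (Mem i j)
      have k: "R (num i) I" "R (num j) I" using vars[OF \<psi>(1)] Mem by auto
      have ?A
        by (rule exI[of _ "num i"], rule conjI[OF k(1)], rule exI[of _ "num j"],
          rule conjI[OF k(2)]) (use RF N_Mem[OF _ k] \<psi>(2) Mem in simp)
      then show ?thesis by blast
    next
      case (Eq i j)
      have k: "R (num i) I" "R (num j) I" using vars[OF \<psi>(1)] Eq by auto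
      have ?B
        by (rule exI[of _ "num i"], rule conjI[OF k(1)], rule exI[of _ "num j"],
          rule conjI[OF k(2)]) (use RF N_Eq[OF _ k] \<psi>(2) Eq in simp)
      then show ?thesis by blast
    next
      case (Neg \<chi>)
      then have L: "\<chi> \<in> ?L" using sub[OF \<psi>(1)] by auto
      then have k: "R (code \<chi>) D" by (simp add: D)
      have ?C
        by (rule exI[of _ "code \<chi>"], rule conjI[OF k]) (use RF R_F[OF L] \<psi>(2) Neg in simp)
      then show ?thesis by blast
    next
      case (Imp \<chi> \<xi>)
      then have L: "\<chi> \<in> ?L" "\<xi> \<in> ?L" using sub[OF \<psi>(1)] by auto
      then have k: "R (code \<chi>) D" "R (code \<xi>) D" by (simp_all add: D)
      have ?D
        by (rule exI[of _ "code \<chi>"], rule conjI[OF k(1)], rule exI[of _ "code \<xi>"],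
          rule conjI[OF k(2)]) (use RF R_F[OF L(1)] R_F[OF L(2)] \<psi>(2) Imp in simp)
      then show ?thesis by blast
    next
      case (All i \<chi>)
      then have L: "\<chi> \<in> ?L" using sub[OF \<psi>(1)] by auto
      then have k: "R (num i) I" "R (code \<chi>) D" using vars[OF \<psi>(1)] All by (auto simp: D)
      have "R (pair d s) F \<longleftrightarrow> (\<forall>r. R r A \<longrightarrow> agree_off i s r \<longrightarrow> R (pair (code \<chi>) r) F)"
        if "R s A" for s
        using RF[OF that] N_All[OF that k(1), of \<chi>] R_F[OF L] All by blast
      then have ?E
        by (intro exI[of _ "num i"] conjI[OF k(1)] exI[of _ "code \<chi>"] conjI[OF k(2)])
          (use \<psi>(2) All in \<open>simp add: agree_off_def\<close>)
      then show ?thesis by blast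
    qed
  qed
  then have "good m \<epsilon> I A D F" by (simp add: good_def S_I' S_A D F R_A)
  moreover have "R (code \<phi>) D" by (simp add: D)
  ultimately show thesis using that by blast
qed

text \<open>The constant function with value \<open>a\<close> is a product. Without any assignment
  the requirement on all assignments in \<open>satisfies\<close> would hold vacuously.\<close>

lemma assignment_exists: "\<exists>s. R s A"
proof -
  obtain a where a: "R a m" using m_nonempty by blast
  then have S: "S a" by (rule S_I)
  have "is_fun (prod I (upair a a)) I m"
    unfolding is_fun_def
  proof (intro conjI allI impI)
    fix p assume "R p (prod I (upair a a))"
    then show "\<exists>i. R i I \<and> (\<exists>x. R x m \<and> p = pair i x)"
      using a S S_I' by auto
  next
    fix i assume "R i I"
    then show "\<exists>x. R x m \<and> R (pair i x) (prod I (upair a a)) \<and>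
        (\<forall>y. R y m \<longrightarrow> R (pair i y) (prod I (upair a a)) \<longrightarrow> y = x)"
      using a S S_I' by (intro exI[of _ a]) (simp add: S_I cong: conj_cong)
  qed
  then have "R (prod I (upair a a)) A" using S_I' S by (simp add: R_A)
  then show ?thesis by blast
qed

lemma assignment_with_values:
  assumes "\<forall>k<n. R (num k) I" "\<forall>k. R (e k) m"
  shows "\<exists>s. R s A \<and> (\<forall>k<n. val s k = e k)"
  using assms
proof (induction n)
  case 0
  then show ?case using assignment_exists by simp
next
  case (Suc n)
  then obtain s where s: "R s A" "\<forall>k<n. val s k = e k" by auto
  obtain r where "R r A" "val r = (val s)(n := e n)"
    using variant[OF s(1), of n "e n"] Suc.prems by blast
  with s(2) show ?case by (intro exI[of _ r]) (auto simp: less_Suc_eq)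
qed

end

section \<open>Internal satisfaction is actual satisfaction\<close>

context basic_model
begin

lemma good_assignments:
  assumes "S m" "S \<epsilon>" "\<exists>x. R x m" "good m \<epsilon> I A D F"
  shows "assignments U R m \<epsilon> I A"
  using assms by unfold_locales (auto simp: good_def)

lemma vars_bounded: obtains n where "k < n" "\<forall>l\<in>fv \<phi> \<union> bv \<phi>. l < n"
proof -
  have "finite (insert k (fv \<phi> \<union> bv \<phi>))" by simp
  then show thesis using that unfolding finite_nat_set_iff_bounded by auto
qed

text \<open>Whatever witnesses the model supplies, \<open>tarski_correct\<close> makes their verdict
  the true one. Conversely, a numeral beyond \<open>k\<close> and all variables of
  \<open>\<phi>\<close> serves as index set for witnesses.\<close>

lemma satisfies_at:
  assumes "S m" "S \<epsilon>" "R y m"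
  shows "(\<exists>I A D F. good m \<epsilon> I A D F \<and> R (code \<phi>) D \<and>
      (\<exists>s. R s A \<and> R (pair (num k) y) s \<and> \<not> R (pair (code \<phi>) s) F)) \<longleftrightarrow>
    (\<exists>e. (\<forall>n. R (e n) m) \<and> e k = y \<and> \<not> sat (inner_U m) (inner_R m \<epsilon>) e \<phi>)"
proof
  assume "\<exists>I A D F. good m \<epsilon> I A D F \<and> R (code \<phi>) D \<and>
      (\<exists>s. R s A \<and> R (pair (num k) y) s \<and> \<not> R (pair (code \<phi>) s) F)"
  then obtain I A D F s where g: "good m \<epsilon> I A D F" "R (code \<phi>) D"
    and s: "R s A" "R (pair (num k) y) s" "\<not> R (pair (code \<phi>) s) F" by blast
  interpret assignments U R m \<epsilon> I A
    by (rule good_assignments) (use assms g in auto)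
  \<comment> \<open>As \<open>s\<close> is a function on \<open>I\<close>, having a value at
    \<open>num k\<close> forces \<open>num k\<close> into \<open>I\<close>.\<close>
  obtain i x where "R i I" "R x m" "pair (num k) y = pair i x"
    using s(1,2) unfolding R_A is_fun_def by blast
  then have k: "R (num k) I" using assms(3) by (auto simp: S_I)
  have "val s k = y" using val_cases(2)[OF s(1) k] s(2) assms(3) S_I by blast
  moreover have "\<not> N (val s) \<phi>"
    using tarski_correct[OF _ g(2) s(1)] g(1) s(3) by (auto simp: good_def)
  ultimately show "\<exists>e. (\<forall>n. R (e n) m) \<and> e k = y \<and> \<not> N e \<phi>"
    using val_in_m[OF s(1)] by blast
next
  assume "\<exists>e. (\<forall>n. R (e n) m) \<and> e k = y \<and> \<not> sat (inner_U m) (inner_R m \<epsilon>) e \<phi>"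
  then obtain e where e: "\<forall>n. R (e n) m" "e k = y" "\<not> sat (inner_U m) (inner_R m \<epsilon>) e \<phi>" by blast
  obtain n where n: "k < n" "\<forall>l\<in>fv \<phi> \<union> bv \<phi>. l < n" by (rule vars_bounded)
  obtain A where A: "S A" "\<And>s. R s A \<longleftrightarrow> S s \<and> is_fun s (num n) m"
    using is_ext_is_fun[OF assms(1), of n] unfolding is_ext_def by blast
  interpret assignments U R m \<epsilon> "num n" A
    by unfold_locales (use assms A in auto)
  obtain D F where g: "good m \<epsilon> (num n) A D F" "R (code \<phi>) D"
    using good_exists[of \<phi>] n(2) by (auto simp: R_num)
  obtain s where s: "R s A" "\<forall>k<n. val s k = e k"
    using assignment_with_values[of n e] e(1) by (auto simp: R_num)
  have "N (val s) \<phi> \<longleftrightarrow> N e \<phi>"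
    by (rule sat_cong) (use s n in auto)
  then have "\<not> R (pair (code \<phi>) s) F"
    using tarski_correct[OF _ g(2) s(1)] g(1) e(3) by (auto simp: good_def)
  moreover have "R (num k) (num n)" using n(1) by (auto simp: R_num)
  then have "R (pair (num k) y) s"
    using val_cases(2)[OF s(1), of k y] s(2) n(1) e(2) assms(3) S_I by auto
  ultimately show "\<exists>I A D F. good m \<epsilon> I A D F \<and> R (code \<phi>) D \<and>
      (\<exists>s. R s A \<and> R (pair (num k) y) s \<and> \<not> R (pair (code \<phi>) s) F)"
    using g s(1) by blast
qed

lemma satisfies_sentence:
  assumes "S m" "S \<epsilon>" "\<exists>x. R x m" "sentence \<phi>"
  shows "(\<exists>I A D F. good m \<epsilon> I A D F \<and> R (code \<phi>) D \<and> (\<forall>s. R s A \<longrightarrow> R (pair (code \<phi>) s) F)) \<longleftrightarrow>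
    (\<forall>e. sat (inner_U m) (inner_R m \<epsilon>) e \<phi>)"
proof
  assume "\<exists>I A D F. good m \<epsilon> I A D F \<and> R (code \<phi>) D \<and> (\<forall>s. R s A \<longrightarrow> R (pair (code \<phi>) s) F)"
  then obtain I A D F where g: "good m \<epsilon> I A D F" "R (code \<phi>) D"
    and s: "\<forall>s. R s A \<longrightarrow> R (pair (code \<phi>) s) F" by blast
  interpret assignments U R m \<epsilon> I A
    by (rule good_assignments) (use assms g in auto)
  obtain s where s': "R s A" using assignment_exists by blast
  then have "N (val s) \<phi>"
    using tarski_correct[OF _ g(2) s'] g(1) s by (auto simp: good_def)
  then show "\<forall>e. N e \<phi>" using sat_sentence[OF assms(4)] by blast
next
  assume N: "\<forall>e. sat (inner_U m) (inner_R m \<epsilon>) e \<phi>"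
  obtain n where n: "0 < n" "\<forall>l\<in>fv \<phi> \<union> bv \<phi>. l < n" by (rule vars_bounded)
  obtain A where A: "S A" "\<And>s. R s A \<longleftrightarrow> S s \<and> is_fun s (num n) m"
    using is_ext_is_fun[OF assms(1), of n] unfolding is_ext_def by blast
  interpret assignments U R m \<epsilon> "num n" A
    by unfold_locales (use assms A in auto)
  obtain D F where g: "good m \<epsilon> (num n) A D F" "R (code \<phi>) D"
    using good_exists[of \<phi>] n(2) by (auto simp: R_num)
  have "\<forall>s. R s A \<longrightarrow> R (pair (code \<phi>) s) F"
    using tarski_correct[OF _ g(2)] g(1) N by (auto simp: good_def)
  with g show "\<exists>I A D F. good m \<epsilon> I A D F \<and> R (code \<phi>) D \<and> (\<forall>s. R s A \<longrightarrow> R (pair (code \<phi>) s) F)"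
    by blast
qed

end

section \<open>Copies of codes and transitivity of inner models\<close>

context model
begin

text \<open>\<open>f\<close> is a bisimulation between membership in the model and the relation
  coded by \<open>\<epsilon>\<close> on \<open>m\<close>. A single formula without recursion
  expresses this, so it can be applied to a code that is the value of a variable.\<close>

definition bisim :: "'a \<Rightarrow> 'a \<Rightarrow> 'a \<Rightarrow> bool" where
  "bisim m \<epsilon> f \<longleftrightarrow> (\<forall>u. S u \<longrightarrow> (\<forall>v. R v m \<longrightarrow> R (pair u v) f \<longrightarrow>
    (\<forall>u'. R u' u \<longrightarrow> (\<exists>v'. R v' m \<and> R (pair v' v) \<epsilon> \<and> R (pair u' v') f)) \<and>
    (\<forall>v'. R v' m \<longrightarrow> R (pair v' v) \<epsilon> \<longrightarrow> (\<exists>u'. R u' u \<and> R (pair u' v') f))))"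

definition bisimilar :: "'a \<Rightarrow> 'a \<Rightarrow> 'a \<Rightarrow> 'a \<Rightarrow> bool" where
  "bisimilar m \<epsilon> u v \<longleftrightarrow> (\<exists>f. S f \<and> bisim m \<epsilon> f \<and> R (pair u v) f)"

end

lemma inner_model:
  assumes "model U R" "\<exists>x. R x m"
  shows "model (model.inner_U R m) (model.inner_R R m \<epsilon>)"
proof -
  interpret model U R by fact
  show ?thesis
    by unfold_locales (use assms(2) in \<open>auto simp: inner_U_def inner_R_def\<close>)
qed

locale model_pair = basic_model U R + N: basic_model "model.inner_U R m" "model.inner_R R m \<epsilon>"
  for U :: "'a set" and R and m and \<epsilon> +
  assumes S_m: "S m" and S_eps: "S \<epsilon>"
begin

lemma N_S: "N.S x \<Longrightarrow> R x m"
  using N.S_U by (auto simp: inner_U_def)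

lemma N_R: "inner_R m \<epsilon> x y \<longleftrightarrow> R x m \<and> R y m \<and> R (pair x y) \<epsilon>"
  by (rule inner_R_def)

text \<open>\<open>copy x x'\<close>: in the sense of the model, \<open>x'\<close> is the only element of the inner model that
  looks like \<open>x\<close>. Hereditarily finite sets have copies although inner models need not be
  well-founded, let alone transitive.\<close>

definition copy :: "'a \<Rightarrow> 'a \<Rightarrow> bool" where
  "copy x x' \<longleftrightarrow> S x \<and> N.S x' \<and> (\<forall>y. R y m \<longrightarrow> (bisimilar m \<epsilon> x y \<longleftrightarrow> y = x'))"

lemma bisim_un:
  assumes "S f" "S g" "bisim m \<epsilon> f" "bisim m \<epsilon> g"
  shows "bisim m \<epsilon> (un f g)"
  using assms(3,4) unfolding bisim_def by (simp add: assms(1,2)) blast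

text \<open>The new pair finds its answers in \<open>f\<close> itself, so adding it leaves nothing
  further to be answered.\<close>

lemma bisim_extend:
  assumes f: "S f" "bisim m \<epsilon> f" and u: "S u" "R v m"
    and zig: "\<And>u'. R u' u \<Longrightarrow> \<exists>v'. inner_R m \<epsilon> v' v \<and> R (pair u' v') f"
    and zag: "\<And>v'. inner_R m \<epsilon> v' v \<Longrightarrow> \<exists>u'. R u' u \<and> R (pair u' v') f"
  shows "bisimilar m \<epsilon> u v"
proof -
  let ?p = "pair u v"
  let ?g = "un f (upair ?p ?p)"
  have S: "S v" "S ?p" using u S_I by auto
  have g: "R w ?g \<longleftrightarrow> R w f \<or> w = ?p" for w
    using f(1) S by simp
  have "bisim m \<epsilon> ?g"
    unfolding bisim_def
  proof (intro allI impI)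
    fix a b assume ab: "S a" "R b m" "R (pair a b) ?g"
    have "(\<forall>a'. R a' a \<longrightarrow> (\<exists>b'. R b' m \<and> R (pair b' b) \<epsilon> \<and> R (pair a' b') f)) \<and>
        (\<forall>b'. R b' m \<longrightarrow> R (pair b' b) \<epsilon> \<longrightarrow> (\<exists>a'. R a' a \<and> R (pair a' b') f))"
    proof (cases "R (pair a b) f")
      case True
      then show ?thesis using f(2) ab(1,2) unfolding bisim_def by blast
    next
      case False
      then have "a = u" "b = v" using ab u S by (auto simp: g S_I)
      then show ?thesis using zig zag u(2) unfolding N_R by blast
    qed
    then show "(\<forall>a'. R a' a \<longrightarrow> (\<exists>b'. R b' m \<and> R (pair b' b) \<epsilon> \<and> R (pair a' b') ?g)) \<and>
        (\<forall>b'. R b' m \<longrightarrow> R (pair b' b) \<epsilon> \<longrightarrow> (\<exists>a'. R a' a \<and> R (pair a' b') ?g))"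
      unfolding g by blast
  qed
  moreover have "S ?g" "R ?p ?g" using f(1) S by (simp_all add: g)
  ultimately show ?thesis unfolding bisimilar_def by blast
qed

lemma bisimilar_zig:
  assumes "bisimilar m \<epsilon> u v" "S u" "R v m" "R u' u"
  obtains v' where "inner_R m \<epsilon> v' v" "bisimilar m \<epsilon> u' v'"
  using assms unfolding bisimilar_def bisim_def N_R by blast

lemma bisimilar_zag:
  assumes "bisimilar m \<epsilon> u v" "S u" "inner_R m \<epsilon> v' v"
  obtains u' where "R u' u" "bisimilar m \<epsilon> u' v'"
  using assms unfolding bisimilar_def bisim_def N_R by blast

text \<open>Adding the pair of \<open>x\<close> and \<open>x'\<close> to \<open>f\<close> makes them
  bisimilar. For uniqueness, the elements of any \<open>y\<close> bisimilar to \<open>x\<close> are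
  bisimilar to elements of \<open>x\<close>, so they are the unique copies of these;
  \<open>y\<close> then has the elements of \<open>x'\<close>, and the inner model is
  extensional.\<close>

lemma copyI:
  assumes x: "S x" "N.S x'" and f: "S f" "bisim m \<epsilon> f"
    and zig: "\<And>u. R u x \<Longrightarrow> \<exists>u'. inner_R m \<epsilon> u' x' \<and> copy u u' \<and> R (pair u u') f"
    and zag: "\<And>u'. inner_R m \<epsilon> u' x' \<Longrightarrow> \<exists>u. R u x \<and> copy u u' \<and> R (pair u u') f"
  shows "copy x x'"
proof -
  have "bisimilar m \<epsilon> x x'"
    by (rule bisim_extend[OF f x(1) N_S[OF x(2)]]) (use zig zag in blast)+
  moreover have "y = x'" if y: "R y m" "bisimilar m \<epsilon> x y" for y
  proof -
    have "inner_R m \<epsilon> w y \<longleftrightarrow> inner_R m \<epsilon> w x'" for w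
    proof
      assume w: "inner_R m \<epsilon> w y"
      then obtain u where u: "R u x" "bisimilar m \<epsilon> u w" using bisimilar_zag[OF y(2) x(1)] by blast
      obtain u' where u': "inner_R m \<epsilon> u' x'" "copy u u'" using zig[OF u(1)] by blast
      have "w = u'" using u'(2) u(2) w unfolding copy_def N_R by blast
      with u'(1) show "inner_R m \<epsilon> w x'" by simp
    next
      assume "inner_R m \<epsilon> w x'"
      then obtain u where u: "R u x" "copy u w" using zag by blast
      obtain v where v: "inner_R m \<epsilon> v y" "bisimilar m \<epsilon> u v"
        using bisimilar_zig[OF y(2) x(1) y(1) u(1)] by blast
      have "v = w" using u(2) v unfolding copy_def N_R by blast
      with v(1) show "inner_R m \<epsilon> w y" by simp
    qed
    then show "y = x'"
      using N.extensionality[of y x'] y(1) N.S_U[OF x(2)] by (simp add: inner_U_def)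
  qed
  ultimately show ?thesis unfolding copy_def using x by blast
qed

lemma copy_bisim:
  assumes "copy x x'"
  obtains f where "S f" "bisim m \<epsilon> f" "R (pair x x') f"
  using assms N_S[of x'] unfolding copy_def bisimilar_def by blast

lemma copy_upair:
  assumes "copy x x'" "copy y y'"
  shows "copy (upair x y) (N.upair x' y')"
proof -
  obtain f where f: "S f" "bisim m \<epsilon> f" "R (pair x x') f" using copy_bisim[OF assms(1)] .
  obtain g where g: "S g" "bisim m \<epsilon> g" "R (pair y y') g" using copy_bisim[OF assms(2)] .
  have S: "S x" "N.S x'" "S y" "N.S y'" using assms by (auto simp: copy_def)
  show ?thesis
    by (rule copyI[of _ _ "un f g"]) (use S f g assms bisim_un in auto)
qed

lemma copy_pair: "copy x x' \<Longrightarrow> copy y y' \<Longrightarrow> copy (pair x y) (N.pair x' y')"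
  unfolding pair_def N.pair_def by (intro copy_upair)

lemma copy_num: "copy (num n) (N.num n)"
proof (induction n rule: less_induct)
  case (less n)
  \<comment> \<open>\<open>copyI\<close> wants one bisimulation for all elements, whereas each
    smaller numeral comes with its own; an auxiliary induction forms their union.\<close>
  have "\<exists>f. S f \<and> bisim m \<epsilon> f \<and> (\<forall>k<n. R (pair (num k) (N.num k)) f)"
    using less
  proof (induction n)
    case 0
    have "bisim m \<epsilon> (num 0)" by (simp add: bisim_def)
    then show ?case by (intro exI[of _ "num 0"]) simp
  next
    case (Suc n)
    then obtain f where f: "S f" "bisim m \<epsilon> f" "\<forall>k<n. R (pair (num k) (N.num k)) f" by auto
    obtain g where g: "S g" "bisim m \<epsilon> g" "R (pair (num n) (N.num n)) g"
      using copy_bisim[OF Suc.prems[of n]] by blast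
    show ?case
      by (rule exI[of _ "un f g"]) (use f g bisim_un in \<open>auto simp: less_Suc_eq\<close>)
  qed
  then obtain f where "S f" "bisim m \<epsilon> f" "\<forall>k<n. R (pair (num k) (N.num k)) f" by blast
  then show ?case
    by (intro copyI[of _ _ f]) (use less in \<open>auto simp: R_num N.R_num\<close>)
qed

lemma copy_code: "copy (code \<phi>) (N.code \<phi>)"
  by (induction \<phi>) (simp_all only: code.simps N.code.simps copy_pair copy_num)

lemma bisimilar_code: "R y m \<Longrightarrow> bisimilar m \<epsilon> (code \<phi>) y \<longleftrightarrow> y = N.code \<phi>"
  using copy_code[of \<phi>] by (simp add: copy_def)

text \<open>Under \<open>R\<close> the element \<open>p\<close> may have elements unrelated to those
  it has in the inner model, so the carrier is separated anew from \<open>m\<close>. The elements of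
  \<open>\<pi>\<close> are pairs in the sense of the inner model and must be replaced by pairs of
  the outer one.\<close>

lemma inner_inner:
  assumes p: "N.S p" and \<pi>: "N.S \<pi>"
  obtains p' \<pi>' where "S p'" "S \<pi>'" "inner_U p' = N.inner_U p" "inner_R p' \<pi>' = N.inner_R p \<pi>"
    and "\<forall>q. R q \<pi>' \<longrightarrow> (\<exists>x. R x p' \<and> (\<exists>y. R y p' \<and> q = pair x y))"
proof -
  have S: "S p" "S \<pi>" using N_S p \<pi> S_I by blast+
  have "is_ext (\<lambda>x. R x m \<and> holds ((\<lambda>_. \<epsilon>)(1 := p, 0 := x)) (bounded_pair_in 0 1 2))"
    by (rule separation) (auto simp: S_m S_eps S)
  then have "is_ext (\<lambda>x. R x m \<and> R (pair x p) \<epsilon>)"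
    by (rule is_ext_cong) (auto simp: S S_I)
  then obtain p' where p': "S p'" "\<And>x. R x p' \<longleftrightarrow> R x m \<and> R (pair x p) \<epsilon>"
    unfolding is_ext_def by blast
  then have R_p': "R x p' \<longleftrightarrow> inner_R m \<epsilon> x p" for x
    using N_S[OF p] by (simp add: N_R)
  \<comment> \<open>\<open>up\<close> and \<open>pr\<close> say with bounded quantifiers that
    something is an unordered or ordered pair of the inner model; variable 1 holds \<open>m\<close>,
    variable 2 holds \<open>\<epsilon>\<close>, and in \<open>pr\<close> variable 7 is the pair of 5
    and 6.\<close>
  define up where "up x y z w = AllIn w 1 (Iff (bounded_pair_in w z 2) (Disj (Eq w x) (Eq w y)))"
    for x y z w
  define pr where "pr = AllIn 8 1 (Iff (bounded_pair_in 8 7 2) (Disj (up 5 5 8 9) (up 5 6 8 9)))"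
  let ?\<phi> = "ExIn 5 3 (ExIn 6 3 (Conj (bounded_pair 5 6 0)
    (ExIn 7 1 (Conj pr (bounded_pair_in 7 4 2)))))"
  let ?e = "(\<lambda>_. num 0)(1 := m, 2 := \<epsilon>, 3 := p', 4 := \<pi>)"
  have bounded_pr: "bounded pr" by (simp add: pr_def up_def)
  have up: "holds e (up x y z w) \<longleftrightarrow> e z = N.upair (e x) (e y)"
    if "e 1 = m" "e 2 = \<epsilon>" "N.S (e x)" "N.S (e y)" "R (e z) m" "w > 2" "w > x" "w > y" "w > z"
    for e x y z w
  proof -
    have "holds e (up x y z w) \<longleftrightarrow> (\<forall>a. R a m \<longrightarrow> (R (pair a (e z)) \<epsilon> \<longleftrightarrow> a = e x \<or> a = e y))"
      using that by (simp add: up_def S_I cong: imp_cong)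
    also have "\<dots> \<longleftrightarrow> e z = N.upair (e x) (e y)"
      using that N_S[OF that(3)] N_S[OF that(4)]
      unfolding N.upair_eq[OF that(3,4)] by (auto simp: inner_U_def N_R)
    finally show ?thesis .
  qed
  have pr: "holds e pr \<longleftrightarrow> e 7 = N.pair (e 5) (e 6)"
    if "e 1 = m" "e 2 = \<epsilon>" "N.S (e 5)" "N.S (e 6)" "R (e 7) m" for e
  proof -
    have "holds e pr \<longleftrightarrow> (\<forall>a. R a m \<longrightarrow> (R (pair a (e 7)) \<epsilon> \<longleftrightarrow>
        a = N.upair (e 5) (e 5) \<or> a = N.upair (e 5) (e 6)))"
      using that by (simp add: pr_def up S_I)
    also have "\<dots> \<longleftrightarrow> e 7 = N.pair (e 5) (e 6)"
      using that N_S[OF N.S_upair[OF that(3,3)]] N_S[OF N.S_upair[OF that(3,4)]]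
      unfolding N.pair_eq[OF that(3,4)] by (auto simp: inner_U_def N_R)
    finally show ?thesis .
  qed
  have "is_ext (\<lambda>q. R q (prod p' p') \<and> holds (?e(0 := q)) ?\<phi>)"
    by (rule separation) (auto simp: p'(1) S_m S_eps S bounded_pr)
  then obtain \<pi>' where \<pi>': "S \<pi>'" "\<And>q. R q \<pi>' \<longleftrightarrow> R q (prod p' p') \<and> holds (?e(0 := q)) ?\<phi>"
    unfolding is_ext_def by blast
  have N_S_p': "N.S x" if "R x p'" for x
    using that N.S_I by (simp add: R_p')
  have phi: "holds (?e(0 := q)) ?\<phi> \<longleftrightarrow>
      (\<exists>x. R x p' \<and> (\<exists>y. R y p' \<and> q = pair x y \<and> inner_R m \<epsilon> (N.pair x y) \<pi>))" for q
  proof -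
    have "holds (?e(0 := q)) ?\<phi> \<longleftrightarrow> (\<exists>x. R x p' \<and> (\<exists>y. R y p' \<and> q = pair x y \<and>
        (\<exists>z. R z m \<and> z = N.pair x y \<and> R (pair z \<pi>) \<epsilon>)))"
      using S by (simp add: S_I pr N_S_p' cong: conj_cong)
    also have "\<dots> \<longleftrightarrow> (\<exists>x. R x p' \<and> (\<exists>y. R y p' \<and> q = pair x y \<and> inner_R m \<epsilon> (N.pair x y) \<pi>))"
      unfolding N_R using N_S[OF \<pi>] by blast
    finally show ?thesis .
  qed
  have R_\<pi>': "R (pair x y) \<pi>' \<longleftrightarrow> inner_R m \<epsilon> (N.pair x y) \<pi>" if "R x p'" "R y p'" for x y
    unfolding \<pi>'(2) phi using that p'(1) by (auto simp: S_I)
  show thesis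
  proof (rule that[OF p'(1) \<pi>'(1)])
    show "inner_U p' = N.inner_U p"
      by (simp add: inner_U_def N.inner_U_def R_p')
    show "inner_R p' \<pi>' = N.inner_R p \<pi>"
      by (intro ext) (use R_\<pi>' in \<open>auto simp: inner_R_def[of p'] N.inner_R_def R_p'\<close>)
    show "\<forall>q. R q \<pi>' \<longrightarrow> (\<exists>x. R x p' \<and> (\<exists>y. R y p' \<and> q = pair x y))"
      using p'(1) by (auto simp: \<pi>'(2))
  qed
qed

end

section \<open>The diagonal argument\<close>

text \<open>Variables 0 and 1 hold the inner model, 3 the code and 9 its possible copy; 10 is the
  bisimulation.\<close>

definition bisimilar_fm :: fm where
  "bisimilar_fm = ExSet 10 (Conj
    (AllSet 11 (AllIn 12 0 (Imp (pair_in 11 12 10) (Conj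
      (AllIn 13 11 (ExIn 14 0 (Conj (pair_in 14 12 1) (pair_in 13 14 10))))
      (AllIn 14 0 (Imp (pair_in 14 12 1) (ExIn 13 11 (pair_in 13 14 10))))))))
    (pair_in 3 9 10))"

text \<open>Variables 4 to 7 are the sets \<open>I\<close>, \<open>A\<close>, \<open>D\<close>,
  \<open>F\<close> of \<open>satisfies\<close>. The numeral 3 in the last conjunct is the index of
  the variable 3, to which the refuting assignment gives the copy as value.\<close>

definition fails_at_copy :: fm where
  "fails_at_copy = ExIn 9 0 (Conj bisimilar_fm (ExSet 4 (ExSet 5 (ExSet 6 (ExSet 7 (Conj
    (All 8 (Iff (Mem 8 5) (Conj (is_set 8) (is_function 8 4 0))))
    (Conj (tarski_clauses 0 1 4 5 6 7) (Conj (Mem 3 6)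
      (Exists 10 (Conj (is_num 3 10) (ExIn 8 5 (Conj (pair_in 10 9 8) (Neg (pair_in 3 8 7))))))))))))))"

text \<open>The variable 3 stands for a code \<open>x\<close>; the formula says that some model of \<open>T\<close> refutes the
  formula coded by \<open>x\<close> when its variable 3 is assigned the copy of \<open>x\<close> in that model. Assigning
  the code as a value avoids arithmetizing substitution.\<close>

definition diagonal :: "fm list \<Rightarrow> fm" where
  "diagonal T = ExSet 0 (ExSet 1 (Conj (is_structure 0 1)
    (foldr (\<lambda>\<phi> \<psi>. Conj (ExSet 2 (Conj (is_code \<phi> 2) (satisfies 0 1 2))) \<psi>) T fails_at_copy)))"

context model
begin

definition inner_structure :: "'a \<Rightarrow> 'a \<Rightarrow> bool" where
  "inner_structure m \<epsilon> \<longleftrightarrow> S m \<and> S \<epsilon> \<and> (\<exists>x. R x m) \<and>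
    (\<forall>p. R p \<epsilon> \<longrightarrow> (\<exists>x. R x m \<and> (\<exists>y. R y m \<and> p = pair x y)))"

end

context basic_model
begin

lemma holds_bisimilar_fm:
  assumes "S (e 0)" "S (e 1)" "S (e 3)" "S (e 9)"
  shows "holds e bisimilar_fm \<longleftrightarrow> bisimilar (e 0) (e 1) (e 3) (e 9)"
  using assms by (simp add: bisimilar_fm_def bisimilar_def bisim_def S_I cong: conj_cong)

lemma holds_fails_at_copy:
  assumes "S (e 0)" "S (e 1)" "S (e 3)"
  shows "holds e fails_at_copy \<longleftrightarrow> (\<exists>y. R y (e 0) \<and> bisimilar (e 0) (e 1) (e 3) y \<and>
    (\<exists>I A D F. good (e 0) (e 1) I A D F \<and> R (e 3) D \<and>
      (\<exists>s. R s A \<and> R (pair (num 3) y) s \<and> \<not> R (pair (e 3) s) F)))"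
proof -
  have "holds e fails_at_copy \<longleftrightarrow> (\<exists>y. R y (e 0) \<and> bisimilar (e 0) (e 1) (e 3) y \<and>
    (\<exists>I. S I \<and> (\<exists>A. S A \<and> (\<exists>D. S D \<and> (\<exists>F. S F \<and> (\<forall>s\<in>U. R s A \<longleftrightarrow> S s \<and> is_fun s I (e 0)) \<and>
      tarski (e 0) (e 1) I A D F \<and> R (e 3) D \<and>
      (\<exists>s. R s A \<and> R (pair (num 3) y) s \<and> \<not> R (pair (e 3) s) F))))))"
    using assms by (simp add: fails_at_copy_def holds_bisimilar_fm S_I cong: conj_cong)
  also have "\<dots> \<longleftrightarrow> (\<exists>y. R y (e 0) \<and> bisimilar (e 0) (e 1) (e 3) y \<and>
    (\<exists>I A D F. good (e 0) (e 1) I A D F \<and> R (e 3) D \<and>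
      (\<exists>s. R s A \<and> R (pair (num 3) y) s \<and> \<not> R (pair (e 3) s) F)))"
    unfolding all_assignments good_def by blast
  finally show ?thesis .
qed

lemma holds_satisfy_all:
  assumes "inner_structure (e 0) (e 1)" "\<forall>\<phi>\<in>set T. sentence \<phi>"
  shows "holds e (foldr (\<lambda>\<phi> \<psi>. Conj (ExSet 2 (Conj (is_code \<phi> 2) (satisfies 0 1 2))) \<psi>) T \<chi>) \<longleftrightarrow>
    (\<forall>\<phi>\<in>set T. \<forall>e'. sat (inner_U (e 0)) (inner_R (e 0) (e 1)) e' \<phi>) \<and> holds e \<chi>"
  using assms(2)
proof (induction T)
  case (Cons \<phi> T)
  have S: "S (e 0)" "S (e 1)" "\<exists>x. R x (e 0)" using assms(1) by (auto simp: inner_structure_def)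
  have "holds e (ExSet 2 (Conj (is_code \<phi> 2) (satisfies 0 1 2))) \<longleftrightarrow>
      (\<exists>c. S c \<and> c = code \<phi> \<and> (\<exists>I A D F. good (e 0) (e 1) I A D F \<and> R c D \<and>
        (\<forall>s. R s A \<longrightarrow> R (pair c s) F)))"
    using S by (simp add: S_U cong: conj_cong)
  also have "\<dots> \<longleftrightarrow> (\<exists>I A D F. good (e 0) (e 1) I A D F \<and> R (code \<phi>) D \<and>
        (\<forall>s. R s A \<longrightarrow> R (pair (code \<phi>) s) F))" by simp
  also have "\<dots> \<longleftrightarrow> (\<forall>e'. sat (inner_U (e 0)) (inner_R (e 0) (e 1)) e' \<phi>)"
    by (rule satisfies_sentence) (use S Cons.prems in auto)
  finally have *: "holds e (ExSet 2 (Conj (is_code \<phi> 2) (satisfies 0 1 2))) \<longleftrightarrow>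
      (\<forall>e'. sat (inner_U (e 0)) (inner_R (e 0) (e 1)) e' \<phi>)" .
  have IH: "holds e (foldr (\<lambda>\<phi> \<psi>. Conj (ExSet 2 (Conj (is_code \<phi> 2) (satisfies 0 1 2))) \<psi>) T \<chi>) \<longleftrightarrow>
    (\<forall>\<phi>\<in>set T. \<forall>e'. sat (inner_U (e 0)) (inner_R (e 0) (e 1)) e' \<phi>) \<and> holds e \<chi>"
    using Cons by simp
  show ?case
    by (simp only: foldr.simps o_apply holds_connectives(1) * IH list.set ball_simps conj_assoc)
qed simp

text \<open>With \<open>\<chi>\<close> left open this evaluates both \<open>exists_model\<close>,
  where \<open>\<chi>\<close> is trivially true, and \<open>diagonal\<close>, where it is
  \<open>fails_at_copy\<close>.\<close>

lemma holds_inner_model: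
  assumes "\<forall>\<phi>\<in>set T. sentence \<phi>"
  shows "holds e (ExSet 0 (ExSet 1 (Conj (is_structure 0 1)
    (foldr (\<lambda>\<phi> \<psi>. Conj (ExSet 2 (Conj (is_code \<phi> 2) (satisfies 0 1 2))) \<psi>) T \<chi>)))) \<longleftrightarrow>
    (\<exists>m \<epsilon>. inner_structure m \<epsilon> \<and>
      (\<forall>\<phi>\<in>set T. \<forall>e'. sat (inner_U m) (inner_R m \<epsilon>) e' \<phi>) \<and> holds (e(0 := m, 1 := \<epsilon>)) \<chi>)"
proof -
  let ?f = "foldr (\<lambda>\<phi> \<psi>. Conj (ExSet 2 (Conj (is_code \<phi> 2) (satisfies 0 1 2))) \<psi>) T \<chi>"
  have "S m \<and> S \<epsilon> \<and> holds (e(0 := m, 1 := \<epsilon>)) (Conj (is_structure 0 1) ?f) \<longleftrightarrow>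
      inner_structure m \<epsilon> \<and> (\<forall>\<phi>\<in>set T. \<forall>e'. sat (inner_U m) (inner_R m \<epsilon>) e' \<phi>) \<and>
      holds (e(0 := m, 1 := \<epsilon>)) \<chi>" for m \<epsilon>
  proof -
    have "S m \<and> S \<epsilon> \<and> holds (e(0 := m, 1 := \<epsilon>)) (Conj (is_structure 0 1) ?f) \<longleftrightarrow>
        inner_structure m \<epsilon> \<and> holds (e(0 := m, 1 := \<epsilon>)) ?f"
      by (auto simp: inner_structure_def)
    then show ?thesis
      using holds_satisfy_all[of "e(0 := m, 1 := \<epsilon>)" T \<chi>] assms by auto
  qed
  then show ?thesis unfolding holds_set_quantifiers(2) by blast
qed

end

text \<open>A property of the structure alone, with the code taken in that structure. It can thus be
  transferred between inner models with equal carrier and relation, no matter which sets code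
  them.\<close>

definition refutes_diagonal :: "fm list \<Rightarrow> 'a set \<Rightarrow> ('a \<Rightarrow> 'a \<Rightarrow> bool) \<Rightarrow> bool" where
  "refutes_diagonal T U R \<longleftrightarrow>
    (\<exists>e. (\<forall>n. e n \<in> U) \<and> e 3 = model.code R (diagonal T) \<and> \<not> sat U R e (diagonal T))"

definition models :: "fm list \<Rightarrow> 'a set \<Rightarrow> ('a \<Rightarrow> 'a \<Rightarrow> bool) \<Rightarrow> bool" where
  "models T U R \<longleftrightarrow> model U R \<and> (\<forall>\<phi>\<in>set T. \<forall>e. sat U R e \<phi>)"

lemma models_sound: "models T U R \<Longrightarrow> set T \<turnstile> \<phi> \<Longrightarrow> (\<And>n. e n \<in> U) \<Longrightarrow> sat U R e \<phi>"
  by (rule soundness) (auto simp: models_def)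

lemma models_basic:
  assumes "axiomatic_set_theory (set T)" "models T U R"
  shows "basic_model U R"
proof -
  interpret model U R using assms(2) by (simp add: models_def)
  show ?thesis
  proof unfold_locales
    fix \<phi> and e :: "nat \<Rightarrow> 'a" assume "\<phi> \<in> basic_axioms" "\<And>n. e n \<in> U"
    then show "sat U R e \<phi>"
      using assms(1) by (intro models_sound[OF assms(2)]) (auto simp: axiomatic_set_theory_def)
  qed
qed

text \<open>This plays the part of the diagonal lemma. In an inner model of \<open>T\<close> the
  element that \<open>fails_at_copy\<close> finds is the code computed there, so by
  \<open>satisfies_at\<close> the failure it describes is \<open>refutes_diagonal\<close> for the
  inner model.\<close>

lemma refutes_diagonal_iff:
  assumes T: "axiomatic_set_theory (set T)" and M: "models T U R"
  shows "refutes_diagonal T U R \<longleftrightarrow> \<not> (\<exists>m \<epsilon>. model.inner_structure R m \<epsilon> \<and>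
    models T (model.inner_U R m) (model.inner_R R m \<epsilon>) \<and>
    refutes_diagonal T (model.inner_U R m) (model.inner_R R m \<epsilon>))"
proof -
  interpret basic_model U R by (rule models_basic[OF T M])
  let ?d = "diagonal T"
  have sent: "\<forall>\<phi>\<in>set T. sentence \<phi>" using T by (simp add: axiomatic_set_theory_def)
  have "holds e ?d \<longleftrightarrow> (\<exists>m \<epsilon>. inner_structure m \<epsilon> \<and> models T (inner_U m) (inner_R m \<epsilon>) \<and>
      refutes_diagonal T (inner_U m) (inner_R m \<epsilon>))" if e: "e 3 = code ?d" for e
  proof -
    have "holds (e(0 := m, 1 := \<epsilon>)) fails_at_copy \<longleftrightarrow> refutes_diagonal T (inner_U m) (inner_R m \<epsilon>)"
      if i: "inner_structure m \<epsilon>" and N: "models T (inner_U m) (inner_R m \<epsilon>)" for m \<epsilon>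
    proof -
      have S: "S m" "S \<epsilon>" using i by (auto simp: inner_structure_def)
      interpret N: basic_model "inner_U m" "inner_R m \<epsilon>" by (rule models_basic[OF T N])
      interpret model_pair U R m \<epsilon> by unfold_locales (use S in auto)
      have c: "R (N.code ?d) m" using N.code_in_U by (simp add: inner_U_def)
      have "holds (e(0 := m, 1 := \<epsilon>)) fails_at_copy \<longleftrightarrow>
          (\<exists>y. R y m \<and> y = N.code ?d \<and> (\<exists>I A D F. good m \<epsilon> I A D F \<and> R (code ?d) D \<and>
            (\<exists>s. R s A \<and> R (pair (num 3) y) s \<and> \<not> R (pair (code ?d) s) F)))"
        using S by (simp add: holds_fails_at_copy e bisimilar_code cong: conj_cong)
      also have "\<dots> \<longleftrightarrow> (\<exists>I A D F. good m \<epsilon> I A D F \<and> R (code ?d) D \<and>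
            (\<exists>s. R s A \<and> R (pair (num 3) (N.code ?d)) s \<and> \<not> R (pair (code ?d) s) F))"
        using c by blast
      also have "\<dots> \<longleftrightarrow> refutes_diagonal T (inner_U m) (inner_R m \<epsilon>)"
        unfolding satisfies_at[OF S c] refutes_diagonal_def by (simp add: inner_U_def)
      finally show ?thesis .
    qed
    moreover have "models T (inner_U m) (inner_R m \<epsilon>) \<longleftrightarrow>
        (\<forall>\<phi>\<in>set T. \<forall>e. sat (inner_U m) (inner_R m \<epsilon>) e \<phi>)" if "inner_structure m \<epsilon>" for m \<epsilon>
      using that inner_model[OF model_axioms] by (auto simp: models_def inner_structure_def)
    ultimately show ?thesis
      unfolding diagonal_def[of T] holds_inner_model[OF sent] by blast
  qed
  \<comment> \<open>Truth has been determined for every assignment with this value at variable 3, so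
    a constant assignment can serve as the witness.\<close>
  then show ?thesis
    unfolding refutes_diagonal_def[of T U R]
    by (auto intro!: exI[of _ "\<lambda>_. code ?d"])
qed

lemma inner_model_exists:
  assumes T: "axiomatic_set_theory (set T)" and M: "models T U R" and "set T \<turnstile> exists_model T"
  obtains m \<epsilon> where "model.inner_structure R m \<epsilon>"
    "models T (model.inner_U R m) (model.inner_R R m \<epsilon>)"
proof -
  interpret basic_model U R by (rule models_basic[OF T M])
  have "holds (\<lambda>_. num 0) (exists_model T)"
    by (rule models_sound[OF M assms(3)]) simp
  then obtain m \<epsilon> where "inner_structure m \<epsilon>"
    "\<forall>\<phi>\<in>set T. \<forall>e. sat (inner_U m) (inner_R m \<epsilon>) e \<phi>"
    unfolding exists_model_def using holds_inner_model[of T] T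
    by (auto simp: axiomatic_set_theory_def)
  then show thesis
    using that inner_model[OF model_axioms] by (auto simp: models_def inner_structure_def)
qed

lemma inner_model_trans:
  assumes T: "axiomatic_set_theory (set T)" and M: "models T U R"
    and i: "model.inner_structure R m \<epsilon>" and N: "models T (model.inner_U R m) (model.inner_R R m \<epsilon>)"
    and j: "model.inner_structure (model.inner_R R m \<epsilon>) p \<pi>"
  obtains p' \<pi>' where "model.inner_structure R p' \<pi>'"
    "model.inner_U R p' = model.inner_U (model.inner_R R m \<epsilon>) p"
    "model.inner_R R p' \<pi>' = model.inner_R (model.inner_R R m \<epsilon>) p \<pi>"
proof -
  interpret basic_model U R by (rule models_basic[OF T M])
  have S: "S m" "S \<epsilon>" using i by (auto simp: inner_structure_def)
  interpret N: basic_model "inner_U m" "inner_R m \<epsilon>" by (rule models_basic[OF T N])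
  interpret model_pair U R m \<epsilon> by unfold_locales (use S in auto)
  have P: "N.S p" "N.S \<pi>" "\<exists>x. inner_R m \<epsilon> x p" using j by (auto simp: N.inner_structure_def)
  obtain p' \<pi>' where *: "S p'" "S \<pi>'" "inner_U p' = N.inner_U p" "inner_R p' \<pi>' = N.inner_R p \<pi>"
      "\<forall>q. R q \<pi>' \<longrightarrow> (\<exists>x. R x p' \<and> (\<exists>y. R y p' \<and> q = pair x y))"
    using inner_inner[OF P(1,2)] .
  moreover have "\<exists>x. R x p'"
    using P(3) *(3) by (auto simp: inner_U_def N.inner_U_def)
  ultimately show thesis using that by (auto simp: inner_structure_def)
qed

theorem mainTheorem1:
  fixes T :: "fm list"
  assumes "axiomatic_set_theory (set T)"
    and "consistent (set T)"
  shows "\<not> set T \<turnstile> exists_model T"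
proof
  assume ex: "set T \<turnstile> exists_model T"
  note T = assms(1)
  \<comment> \<open>\<open>U\<close> and \<open>R\<close> are arbitrary over the type
    \<open>nat\<close>, on which inner models live too, so this applies to them as well.\<close>
  have none: "\<not> refutes_diagonal T U R" if M: "models T U R" for U :: "nat set" and R
  proof
    assume "refutes_diagonal T U R"
    then have no: "\<not> refutes_diagonal T (model.inner_U R m) (model.inner_R R m \<epsilon>)"
      if "model.inner_structure R m \<epsilon>" "models T (model.inner_U R m) (model.inner_R R m \<epsilon>)" for m \<epsilon>
      using refutes_diagonal_iff[OF T M] that by blast
    obtain m \<epsilon> where N: "model.inner_structure R m \<epsilon>"
      "models T (model.inner_U R m) (model.inner_R R m \<epsilon>)"
      using inner_model_exists[OF T M ex] .
    let ?U = "model.inner_U R m" and ?R = "model.inner_R R m \<epsilon>"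
    obtain p \<pi> where P: "model.inner_structure ?R p \<pi>"
      "models T (model.inner_U ?R p) (model.inner_R ?R p \<pi>)"
      "refutes_diagonal T (model.inner_U ?R p) (model.inner_R ?R p \<pi>)"
      using no[OF N] refutes_diagonal_iff[OF T N(2)] by blast
    obtain p' \<pi>' where "model.inner_structure R p' \<pi>'"
      "model.inner_U R p' = model.inner_U ?R p" "model.inner_R R p' \<pi>' = model.inner_R ?R p \<pi>"
      using inner_model_trans[OF T M N P(1)] .
    with no P(2,3) show False by metis
  qed
  obtain U :: "nat set" and R where "U \<noteq> {}" "\<And>a b. R a b \<Longrightarrow> a \<in> U \<and> b \<in> U"
    "\<And>\<phi> e. \<phi> \<in> set T \<Longrightarrow> sat U R e \<phi>"
    using model_existence[of "set T"] T assms(2) by (auto simp: axiomatic_set_theory_def)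
  then have M: "models T U R"
    unfolding models_def by (intro conjI model.intro) auto
  then obtain m \<epsilon> where "models T (model.inner_U R m) (model.inner_R R m \<epsilon>)"
    "refutes_diagonal T (model.inner_U R m) (model.inner_R R m \<epsilon>)"
    using none refutes_diagonal_iff[OF T M] by blast
  then show False using none by blast
qed

end
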